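(* Fix $h$, and for $1\le j\le s$ fix $\alpha^{(j)}\in\mathbb N^h$ and $\beta^{(j)}\in\mathbb Z^h$. Suppose that, for each $j$, $N\alpha^{(j)}+\beta^{(j)}$ is nonnegative for all sufficiently large $N$. For sufficiently large $N$, let $w_j(N)$ be the permutation whose Lehmer code is obtained from $N\alpha^{(j)}+\beta^{(j)}$ by appending enough trailing zeroes to satisfy the Lehmer-code inequalities. Then for every fixed $\nu\in\mathbb N^h$ and $\eta\in\mathbb Z^h$, the coefficient $$[\mathbf x^{N\nu+\eta}]\prod_{j=1}^s\mathfrak S_{w_j(N)}(\mathbf x)$$ is eventually polynomial in $N$, that is, it agrees with a polynomial $P(N)$ for all sufficiently large $N$. Moreover, if for all sufficiently large $N$ the total degree of $N\nu+\eta$ differs from the sum over $j$ of the total degrees of $N\alpha^{(j)}+\beta^{(j)}$, then the coefficient is $0$ for all sufficiently large $N$.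
   Context: $\mathbb N=\{0,1,2,\dots\}$; $\mathbf x=(x_1,\dots,x_h)$; $\mathbf x^a=x_1^{a_1}\cdots x_h^{a_h}$ for $a\in\mathbb Z^h$; $[\mathbf x^a]f$ is the coefficient of $\mathbf x^a$ in $f$; the total degree of a vector is the sum of its entries. The Lehmer code of $w\in S_m$ is $\mathrm{code}(w)_i=\#\{j>i: w(j)<w(i)\}$, $1\le i\le m$. If $\gamma\in\mathbb N^h$ and $t$ satisfies the Lehmer-code inequalities $\gamma_i\le h+t-i$ for all $i$, then $(\gamma_1,\dots,\gamma_h,0^t)$ is the Lehmer code of a unique permutation in $S_{h+t}$; increasing $t$ only appends fixed points. Schubert polynomials $\mathfrak S_w$: for the longest element $w_0\in S_m$, $\mathfrak S_{w_0}=x_1^{m-1}x_2^{m-2}\cdots x_{m-1}$, and $\mathfrak S_{ws_i}=\partial_i\mathfrak S_w$ whenever $w(i)>w(i+1)$, where $\partial_i f=(f-s_if)/(x_i-x_{i+1})$ and $s_i$ exchanges $x_i$ and $x_{i+1}$. They do not change when fixed points are appended to $w$. If the code of $w$ vanishes after position $h$, then $\mathfrak S_w\in\mathbb Z[x_1,\dots,x_h]$. *)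

theory Defs
  imports
    "HOL-Library.Poly_Mapping"
    "HOL-Computational_Algebra.Polynomial"
    "HOL-Combinatorics.Permutations"
begin

text \<open>
  Integer polynomials in the variables $x_0, x_1, x_2, \ldots$: finitely supported maps from
  exponent vectors to coefficients, multiplied by convolution. The variable $x_0$ is never used.
\<close>

type_synonym mpoly = "(nat \<Rightarrow>\<^sub>0 nat) \<Rightarrow>\<^sub>0 int"

definition var :: "nat \<Rightarrow> mpoly" where
  "var i = Poly_Mapping.single (Poly_Mapping.single i 1) 1"

text \<open>
  Exchanging $x_i$ and $x_{i+1}$. The inner \<open>map_key\<close> exchanges the exponents at \<open>i\<close> and \<open>i + 1\<close>;
  both key maps are involutions, so the side condition of injectivity on \<open>map_key\<close> is met.
\<close>

definition swap_exponents :: "nat \<Rightarrow> (nat \<Rightarrow>\<^sub>0 nat) \<Rightarrow> (nat \<Rightarrow>\<^sub>0 nat)" where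
  "swap_exponents i = Poly_Mapping.map_key (transpose i (Suc i))"

definition swap_vars :: "nat \<Rightarrow> mpoly \<Rightarrow> mpoly" where
  "swap_vars i = Poly_Mapping.map_key (swap_exponents i)"

lemma lookup_swap_exponents:
  "Poly_Mapping.lookup (swap_exponents i e) k = Poly_Mapping.lookup e (transpose i (Suc i) k)"
  unfolding swap_exponents_def by (simp add: map_key.rep_eq)

lemma swap_exponents_involutory: "swap_exponents i (swap_exponents i e) = e"
  by (rule poly_mapping_eqI) (simp add: lookup_swap_exponents)

lemma inj_swap_exponents: "inj (swap_exponents i)"
  by (metis injI swap_exponents_involutory)

lemma lookup_swap_vars:
  "Poly_Mapping.lookup (swap_vars i f) e = Poly_Mapping.lookup f (swap_exponents i e)"
  unfolding swap_vars_def by (simp add: map_key.rep_eq inj_swap_exponents)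

text \<open>
  The divided difference is the exact quotient of $f - s_i f$ by $x_i - x_{i+1}$. The ring is an
  integral domain, so there is at most one quotient.
\<close>

definition divided_difference :: "nat \<Rightarrow> mpoly \<Rightarrow> mpoly" where
  "divided_difference i f = (THE g. (var i - var (Suc i)) * g = f - swap_vars i f)"

lemma var_neq: "i \<noteq> j \<Longrightarrow> var i \<noteq> var j"
  unfolding var_def by (metis lookup_single_eq lookup_single_not_eq one_neq_zero)

lemma divided_difference_eqI:
  assumes "(var i - var (Suc i)) * g = f - swap_vars i f"
  shows "divided_difference i f = g"
  unfolding divided_difference_def
proof (rule the_equality)
  have "var i - var (Suc i) \<noteq> 0" using var_neq[of i "Suc i"] by simp
  then show "g' = g" if "(var i - var (Suc i)) * g' = f - swap_vars i f" for g'
    using assms that by (metis mult_left_cancel)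
qed (fact assms)

text \<open>
  A permutation in $S_m$ is a function that permutes \<open>{1..m}\<close>, and so is the identity elsewhere.
  Hence appending fixed points changes \<open>m\<close> but not the function.
\<close>

definition longest_perm :: "nat \<Rightarrow> nat \<Rightarrow> nat" where
  "longest_perm m i = (if i \<in> {1..m} then m + 1 - i else i)"

definition lehmer_code :: "nat \<Rightarrow> (nat \<Rightarrow> nat) \<Rightarrow> nat \<Rightarrow> nat" where
  "lehmer_code m w i = card {j \<in> {i<..m}. w j < w i}"

text \<open>
  \<open>is_schubert m\<close> is the graph generated by the two defining rules of the Schubert polynomials
  of $S_m$. It is the graph of a function on $S_m$ since the divided differences satisfy the braid
  relations.
\<close>

inductive is_schubert :: "nat \<Rightarrow> (nat \<Rightarrow> nat) \<Rightarrow> mpoly \<Rightarrow> bool" for m where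
  longest: "is_schubert m (longest_perm m) (\<Prod>i\<in>{1..<m}. var i ^ (m - i))"
| descent: "is_schubert m (w \<circ> transpose i (Suc i)) (divided_difference i f)"
    if "is_schubert m w f" "1 \<le> i" "i < m" "w i > w (Suc i)"

definition schubert :: "nat \<Rightarrow> (nat \<Rightarrow> nat) \<Rightarrow> mpoly" where
  "schubert m w = (THE f. is_schubert m w f)"

text \<open>
  Vectors in $\mathbb{Z}^h$ are functions of which only the values on \<open>{1..h}\<close> matter.
\<close>

definition lehmer_ineqs :: "nat \<Rightarrow> nat \<Rightarrow> (nat \<Rightarrow> int) \<Rightarrow> bool" where
  "lehmer_ineqs h t \<gamma> \<longleftrightarrow> (\<forall>i\<in>{1..h}. \<gamma> i \<le> int h + int t - int i)"

text \<open>
  The permutation in $S_{h+t}$ with Lehmer code $(\gamma_1, \ldots, \gamma_h, 0^t)$; meaningful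
  if \<open>\<gamma>\<close> is nonnegative and satisfies the Lehmer-code inequalities.
\<close>

definition code_perm :: "nat \<Rightarrow> nat \<Rightarrow> (nat \<Rightarrow> int) \<Rightarrow> nat \<Rightarrow> nat" where
  "code_perm h t \<gamma> = (THE w. w permutes {1..h + t} \<and>
     (\<forall>i\<in>{1..h + t}. int (lehmer_code (h + t) w i) = (if i \<le> h then \<gamma> i else 0)))"

text \<open>
  The coefficient of $x_1^{a_1} \cdots x_h^{a_h}$ for an integer vector \<open>a\<close>; it is \<open>0\<close> if \<open>a\<close>
  has a negative entry.
\<close>

definition monomial_exponent :: "nat \<Rightarrow> (nat \<Rightarrow> int) \<Rightarrow> (nat \<Rightarrow>\<^sub>0 nat)" where
  "monomial_exponent h a = (\<Sum>i\<in>{1..h}. Poly_Mapping.single i (nat (a i)))"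

definition coefficient :: "nat \<Rightarrow> (nat \<Rightarrow> int) \<Rightarrow> mpoly \<Rightarrow> int" where
  "coefficient h a f =
     (if \<forall>i\<in>{1..h}. 0 \<le> a i then Poly_Mapping.lookup f (monomial_exponent h a) else 0)"

definition total_degree :: "nat \<Rightarrow> (nat \<Rightarrow> int) \<Rightarrow> int" where
  "total_degree h a = (\<Sum>i\<in>{1..h}. a i)"

definition ray :: "(nat \<Rightarrow> nat) \<Rightarrow> (nat \<Rightarrow> int) \<Rightarrow> nat \<Rightarrow> nat \<Rightarrow> int" where
  "ray \<alpha> \<beta> N i = int N * int (\<alpha> i) + \<beta> i"

end

theory Submission
  imports Defs
begin

text \<open>
  Let $\gamma$ be a code supported on the first $h$ positions. If $\gamma_i \le \gamma_{i+1}$, then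
  $\mathfrak S_\gamma = \partial_i \mathfrak S_{\gamma'}$, where $\gamma'$ arises from $\gamma$ by
  replacing $(\gamma_i, \gamma_{i+1})$ by $(\gamma_{i+1} + 1, \gamma_i)$; and
  $\mathfrak S_\gamma = x^\gamma$ if $\gamma$ is weakly decreasing. Along a ray all comparisons of
  entries are eventually constant, so sorting the code gives a word in $\partial_1, \ldots,
  \partial_{h-1}$, independent of $N$, which produces $\mathfrak S_{w(N)}$ from a monomial
  $x^{N\alpha' + \beta'}$. Hence some product $D$ of differences $x_i - x_j$, independent of $N$,
  turns the product of the Schubert polynomials into a fixed finite sum of terms
  $c \, x^{N\lambda + \kappa}$.

  To divide by $D$, expand $1/D$ in powers of $x_j/x_i$, $i < j$. By partial fractions
  $1/D$ is a combination of inverse products in which, for each $j$, at most one distinct factor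
  $x_i - x_j$ with $i < j$ occurs, and for these the coefficients along a ray are products of binomial
  coefficients of affine functions of $N$. The claim on degrees holds since Schubert polynomials
  are homogeneous.
\<close>

text \<open>Fractions with denominator D are never formed. A function on integer exponent vectors
  plays the role of a formal Laurent series, and 1/D is replaced by a function K such that D times K
  is the series 1. Letting a numerator D * F(N) act on K returns F(N), and each monomial of the
  numerator merely translates K, so only values of K along rays matter. The obstacle is that
  coefficient functions of inverse products are in general only piecewise quasi-polynomial. The
  pieces disappear along a single ray, because an affine function of N has eventually constant sign;
  periodicity does not arise, because the binomials obtained from differences x_i - x_j have
  arguments that are affine in N with integer coefficients. A second point is torsion: among doubly
  infinite series, any function constant along e_i - e_j is annihilated by x_i - x_j, and a decay
  condition is imposed to restore cancellation. The number t of trailing zeroes never enters, since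
  the sorting word and the final monomial are the same for every admissible t.\<close>

lemma mpoly_induct [case_names single add]:
  fixes p :: "'a \<Rightarrow>\<^sub>0 'b :: comm_monoid_add"
  assumes single: "\<And>e c. P (Poly_Mapping.single e c)"
    and add: "\<And>p q. P p \<Longrightarrow> P q \<Longrightarrow> P (p + q)"
  shows "P p"
proof (induction p rule: update_induct)
  case const
  show ?case using single[of undefined 0] by simp
next
  case (update p e c)
  have "Poly_Mapping.update e c p = p + Poly_Mapping.single e c"
    using update(1)
    by (intro poly_mapping_eqI) (auto simp: lookup_update lookup_add lookup_single in_keys_iff)
  then show ?case using update add single by metis
qed

section \<open>Polynomials acting on functions on the exponent lattice\<close>

text \<open>\<open>f\<close> stands for the formal sum of f(a) x^a over integer vectors a, and
  \<open>act p f\<close> for its product with \<open>p\<close>. Only polynomials act: the product of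
  two such sums need not be defined.\<close>

definition act :: "mpoly \<Rightarrow> ((nat \<Rightarrow> int) \<Rightarrow> int) \<Rightarrow> (nat \<Rightarrow> int) \<Rightarrow> int" where
  "act p f a = (\<Sum>b\<in>Poly_Mapping.keys p.
     Poly_Mapping.lookup p b * f (\<lambda>i. a i - int (Poly_Mapping.lookup b i)))"

lemma act_superset:
  assumes "finite S" "Poly_Mapping.keys p \<subseteq> S"
  shows "act p f a =
    (\<Sum>b\<in>S. Poly_Mapping.lookup p b * f (\<lambda>i. a i - int (Poly_Mapping.lookup b i)))"
  unfolding act_def by (rule sum.mono_neutral_left) (use assms in \<open>auto simp: in_keys_iff\<close>)

lemma act_add: "act (p + q) f a = act p f a + act q f a"
proof -
  let ?S = "Poly_Mapping.keys p \<union> Poly_Mapping.keys q"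
  have "finite ?S" "Poly_Mapping.keys (p + q) \<subseteq> ?S" using keys_add[of p q] by auto
  then show ?thesis
    by (simp add: act_superset[of ?S] lookup_add distrib_right sum.distrib)
qed

lemma act_single:
  "act (Poly_Mapping.single b c) f a = c * f (\<lambda>i. a i - int (Poly_Mapping.lookup b i))"
  by (cases "c = 0") (simp_all add: act_def)

lemma act_one [simp]: "act 1 f = f"
  unfolding single_one[symmetric] by (rule ext) (simp only: act_single, simp)

lemma act_var: "act (var i) f a = f (a(i := a i - 1))"
proof -
  have "(\<lambda>k. a k - int (Poly_Mapping.lookup (Poly_Mapping.single i 1) k)) = a(i := a i - 1)"
    by (auto simp: lookup_single when_def)
  then show ?thesis by (simp add: var_def act_single)
qed

lemma act_diff_right: "act p (\<lambda>a. f a - g a) a = act p f a - act p g a"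
  by (simp add: act_def right_diff_distrib sum_subtractf)

lemma act_uminus: "act (- p) f a = - act p f a"
  by (simp add: act_def sum_negf)

lemma act_diff: "act (p - q) f a = act p f a - act q f a"
  using act_add[of p "- q"] by (simp add: act_uminus)

lemma act_mult: "act (p * q) f = act p (act q f)"
proof (rule ext, induction p rule: mpoly_induct)
  case (single e c)
  show ?case
  proof (induction q rule: mpoly_induct)
    case (single e' c')
    show ?case by (simp add: mult_single act_single lookup_add algebra_simps)
  next
    case (add q q')
    then show ?case by (simp add: distrib_left act_add act_single)
  qed
next
  case (add p p')
  then show ?case by (simp add: distrib_right act_add)
qed

definition delta :: "(nat \<Rightarrow> int) \<Rightarrow> int" where
  "delta a = (if a = (\<lambda>_. 0) then 1 else 0)"

text \<open>\<open>delta\<close> is the series 1, so multiplying it by \<open>p\<close> recovers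
  \<open>p\<close>. This is where coefficients of polynomials are read off on the lattice.\<close>

lemma act_delta: "act p delta (\<lambda>i. int (Poly_Mapping.lookup e i)) = Poly_Mapping.lookup p e"
proof -
  have "delta (\<lambda>i. int (Poly_Mapping.lookup e i) - int (Poly_Mapping.lookup b i)) =
      (if b = e then 1 else 0)" for b
    by (auto simp: delta_def fun_eq_iff intro!: poly_mapping_eqI)
  then have "act p delta (\<lambda>i. int (Poly_Mapping.lookup e i)) =
      (\<Sum>b\<in>Poly_Mapping.keys p. if b = e then Poly_Mapping.lookup p b else 0)"
    unfolding act_def by (intro sum.cong) (simp_all only:, simp_all)
  then show ?thesis by (simp add: in_keys_iff)
qed

text \<open>
  On tame functions multiplication by $x_i - x_j$, for $i < j$, is injective, so that
  $1/(x_i - x_j)$, expanded in powers of $x_j/x_i$, is unambiguous.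
\<close>

definition tame :: "((nat \<Rightarrow> int) \<Rightarrow> int) \<Rightarrow> bool" where
  "tame f \<longleftrightarrow> (\<forall>i j a. i < j \<longrightarrow>
     (\<forall>\<^sub>F k in sequentially. f (a(i := a i + int k, j := a j - int k)) = 0))"

lemma tameD:
  "tame f \<Longrightarrow> i < j \<Longrightarrow>
     \<forall>\<^sub>F k in sequentially. f (a(i := a i + int k, j := a j - int k)) = 0"
  by (auto simp: tame_def)

lemma tame_delta: "tame delta"
  unfolding tame_def
proof (intro allI impI)
  fix i j :: nat and a :: "nat \<Rightarrow> int"
  assume "i < j"
  show "\<forall>\<^sub>F k in sequentially. delta (a(i := a i + int k, j := a j - int k)) = 0"
    using eventually_gt_at_top[of "nat \<bar>a i\<bar>"]
  proof eventually_elim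
    case (elim k)
    then have "(a(i := a i + int k, j := a j - int k)) i \<noteq> 0" using \<open>i < j\<close> by auto
    then show ?case unfolding delta_def by metis
  qed
qed

lemma tame_diff:
  assumes "tame f" "tame g"
  shows "tame (\<lambda>a. f a - g a)"
  unfolding tame_def
proof (intro allI impI)
  fix i j :: nat and a :: "nat \<Rightarrow> int"
  assume "i < j"
  show "\<forall>\<^sub>F k in sequentially. f (a(i := a i + int k, j := a j - int k)) -
      g (a(i := a i + int k, j := a j - int k)) = 0"
    using tameD[OF assms(1) \<open>i < j\<close>, of a] tameD[OF assms(2) \<open>i < j\<close>, of a]
    by eventually_elim simp
qed

text \<open>A polynomial uses only finitely many translates of \<open>f\<close>, and each of them
  vanishes far out in the given direction.\<close>

lemma tame_act:
  assumes "tame f"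
  shows "tame (act p f)"
  unfolding tame_def
proof (intro allI impI)
  fix i j :: nat and a :: "nat \<Rightarrow> int"
  assume "i < j"
  have "\<forall>\<^sub>F k in sequentially. \<forall>b\<in>Poly_Mapping.keys p.
      f (\<lambda>l. (a(i := a i + int k, j := a j - int k)) l - int (Poly_Mapping.lookup b l)) = 0"
  proof (rule eventually_ball_finite, simp, rule ballI)
    fix b
    let ?a = "\<lambda>l. a l - int (Poly_Mapping.lookup b l)"
    have *: "?a(i := ?a i + int k, j := ?a j - int k) =
      (\<lambda>l. (a(i := a i + int k, j := a j - int k)) l - int (Poly_Mapping.lookup b l))" for k
      by (rule ext) (use \<open>i < j\<close> in simp)
    show "\<forall>\<^sub>F k in sequentially.
      f (\<lambda>l. (a(i := a i + int k, j := a j - int k)) l - int (Poly_Mapping.lookup b l)) = 0"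
      using tameD[OF assms \<open>i < j\<close>, of ?a] unfolding * .
  qed
  then show "\<forall>\<^sub>F k in sequentially. act p f (a(i := a i + int k, j := a j - int k)) = 0"
    by eventually_elim (simp add: act_def)
qed

text \<open>A function killed by x_i - x_j is invariant under translation by e_i - e_j, so its value
  at \<open>a\<close> is also taken arbitrarily far out, where tameness makes it 0.\<close>

lemma tame_cancel_zero:
  assumes f: "tame f" and "i < j" and zero: "\<And>a. act (var i - var j) f a = 0"
  shows "f a = 0"
proof -
  have step: "f (a(i := a i + 1, j := a j - 1)) = f a" for a
    using zero[of "a(i := a i + 1)"] \<open>i < j\<close> by (simp add: act_diff act_var fun_upd_twist)
  have "f (a(i := a i + int k, j := a j - int k)) = f a" for k
  proof (induction k)
    case (Suc k)
    let ?b = "a(i := a i + int k, j := a j - int k)"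
    have "a(i := a i + int (Suc k), j := a j - int (Suc k)) = ?b(i := ?b i + 1, j := ?b j - 1)"
      using \<open>i < j\<close> by (auto simp: fun_eq_iff)
    then show ?case using step[of ?b] Suc by (simp only:)
  qed simp
  then show ?thesis
    using eventually_happens'[OF _ tameD[OF f \<open>i < j\<close>, of a]] by auto
qed

lemma tame_cancel:
  assumes "tame f" "tame g" "i < j" "act (var i - var j) f = act (var i - var j) g"
  shows "f = g"
proof
  fix a
  have "act (var i - var j) (\<lambda>a. f a - g a) b = 0" for b
    using assms(4) by (simp add: act_diff_right)
  then show "f a = g a"
    using tame_cancel_zero[OF tame_diff[OF assms(1,2)] assms(3)] by fastforce
qed

section \<open>Eventually polynomial sequences\<close>

text \<open>Rational coefficients are forced: binomial coefficients are integers, but as polynomials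
  they have denominators.\<close>

definition evpoly :: "(nat \<Rightarrow> rat) \<Rightarrow> bool" where
  "evpoly f \<longleftrightarrow> (\<exists>P :: rat poly. \<forall>\<^sub>F N in sequentially. f N = poly P (of_nat N))"

lemma evpolyI: "\<forall>\<^sub>F N in sequentially. f N = poly P (of_nat N) \<Longrightarrow> evpoly f"
  by (auto simp: evpoly_def)

lemma evpoly_eventually_const:
  assumes "\<forall>\<^sub>F N in sequentially. f N = c"
  shows "evpoly f"
  by (rule evpolyI[of _ "[:c:]"]) (use assms in simp)

lemma evpoly_cong:
  assumes "\<forall>\<^sub>F N in sequentially. f N = g N"
  shows "evpoly f \<longleftrightarrow> evpoly g"
proof -
  have "(\<forall>\<^sub>F N in sequentially. f N = poly P (of_nat N)) \<longleftrightarrow>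
      (\<forall>\<^sub>F N in sequentially. g N = poly P (of_nat N))" for P
    by (rule eventually_cong[OF assms]) auto
  then show ?thesis by (simp add: evpoly_def)
qed

lemma evpoly_poly: "evpoly (\<lambda>N. poly P (of_nat N))"
  by (rule evpolyI[of _ P]) simp

lemma evpoly_const: "evpoly (\<lambda>N. c)"
  using evpoly_poly[of "[:c:]"] by simp

lemma evpoly_add:
  assumes "evpoly f" "evpoly g"
  shows "evpoly (\<lambda>N. f N + g N)"
proof -
  from assms obtain P Q where "\<forall>\<^sub>F N in sequentially. f N = poly P (of_nat N)"
    "\<forall>\<^sub>F N in sequentially. g N = poly Q (of_nat N)" by (auto simp: evpoly_def)
  then have "\<forall>\<^sub>F N in sequentially. f N + g N = poly (P + Q) (of_nat N)"
    by eventually_elim simp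
  then show ?thesis by (rule evpolyI)
qed

lemma evpoly_mult:
  assumes "evpoly f" "evpoly g"
  shows "evpoly (\<lambda>N. f N * g N)"
proof -
  from assms obtain P Q where "\<forall>\<^sub>F N in sequentially. f N = poly P (of_nat N)"
    "\<forall>\<^sub>F N in sequentially. g N = poly Q (of_nat N)" by (auto simp: evpoly_def)
  then have "\<forall>\<^sub>F N in sequentially. f N * g N = poly (P * Q) (of_nat N)"
    by eventually_elim simp
  then show ?thesis by (rule evpolyI)
qed

lemma evpoly_diff:
  assumes "evpoly f" "evpoly g"
  shows "evpoly (\<lambda>N. f N - g N)"
  using evpoly_add[OF assms(1) evpoly_mult[OF evpoly_const[of "-1"] assms(2)]] by simp

lemma evpoly_sum:
  assumes "\<And>x. x \<in> S \<Longrightarrow> evpoly (f x)"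
  shows "evpoly (\<lambda>N. \<Sum>x\<in>S. f x N)"
  using assms by (induction S rule: infinite_finite_induct) (auto intro: evpoly_add evpoly_const)

text \<open>Along a ray a comparison cannot oscillate. This settles the sign of binomial arguments,
  negative target exponents and the comparisons made while sorting a code.\<close>

lemma affine_sign_eventually:
  fixes u v :: int
  shows "(\<forall>\<^sub>F N in sequentially. 0 \<le> int N * u + v) \<or> (\<forall>\<^sub>F N in sequentially. int N * u + v < 0)"
proof -
  consider "u > 0" | "u < 0" | "u = 0" "v \<ge> 0" | "u = 0" "v < 0" by linarith
  then show ?thesis
  proof cases
    case 1
    have "\<forall>\<^sub>F N in sequentially. 0 \<le> int N * u + v"
      using eventually_ge_at_top[of "nat \<bar>v\<bar>"]
    proof eventually_elim
      case (elim N)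
      have "int N * 1 \<le> int N * u" using 1 by (intro mult_left_mono) auto
      with elim show ?case by linarith
    qed
    then show ?thesis ..
  next
    case 2
    have "\<forall>\<^sub>F N in sequentially. int N * u + v < 0"
      using eventually_gt_at_top[of "nat \<bar>v\<bar>"]
    proof eventually_elim
      case (elim N)
      have "int N * u \<le> int N * (-1)" using 2 by (intro mult_left_mono) auto
      with elim show ?case by linarith
    qed
    then show ?thesis ..
  qed auto
qed

text \<open>By (m+1) C(k+m+1, m+1) = (k+m+1) C(k+m, m), each step multiplies the polynomial by a
  linear factor in k and a constant.\<close>

lemma binomial_polynomial:
  "\<exists>P :: rat poly. \<forall>k. of_nat ((k + m) choose m) = poly P (of_nat k)"
proof (induction m)
  case 0
  show ?case by (rule exI[of _ 1]) simp
next
  case (Suc m)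
  then obtain P :: "rat poly" where P: "\<And>k. of_nat ((k + m) choose m) = poly P (of_nat k)" by auto
  have "of_nat ((k + Suc m) choose Suc m) =
      poly (smult (1 / of_nat (Suc m)) (P * [:of_nat (Suc m), 1:])) (of_nat k :: rat)" for k
  proof -
    have "Suc m * ((k + Suc m) choose Suc m) = (k + Suc m) * ((k + m) choose m)"
      using Suc_times_binomial_eq[of "k + m" m] by (simp add: mult.commute)
    then have "(of_nat (Suc m) * of_nat ((k + Suc m) choose Suc m) :: rat) =
        of_nat (k + Suc m) * poly P (of_nat k)"
      unfolding P[symmetric] by (metis of_nat_mult)
    then show ?thesis by (simp add: field_simps)
  qed
  then show ?case by blast
qed

text \<open>The coefficient of $u^k$ in $(1 - u)^{-m}$; the truncated subtraction gives $1$ at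
  $m = k = 0$, as it should.\<close>

definition neg_binomial :: "nat \<Rightarrow> int \<Rightarrow> int" where
  "neg_binomial m k = (if k < 0 then 0 else int ((nat k + m - 1) choose nat k))"

lemma neg_binomial_neg [simp]: "k < 0 \<Longrightarrow> neg_binomial m k = 0"
  by (simp add: neg_binomial_def)

lemma neg_binomial_0: "neg_binomial 0 k = (if k = 0 then 1 else 0)"
  by (auto simp: neg_binomial_def intro!: binomial_eq_0)

text \<open>This compares coefficients in (1 - u) (1 - u)^(-m-1) = (1 - u)^(-m); for positive k it
  is Pascal's rule.\<close>

lemma neg_binomial_Suc: "neg_binomial (Suc m) k - neg_binomial (Suc m) (k - 1) = neg_binomial m k"
proof (cases "k \<le> 0")
  case True
  then show ?thesis by (cases "k = 0") (auto simp: neg_binomial_def)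
next
  case False
  then obtain n where "k = int (Suc n)"
    by (metis gr0_implies_Suc not_less zero_less_imp_eq_int)
  then show ?thesis by (simp add: neg_binomial_def nat_add_distrib)
qed

lemma evpoly_neg_binomial: "evpoly (\<lambda>N. of_int (neg_binomial m (int N * u + v)))"
proof -
  consider "\<forall>\<^sub>F N in sequentially. 0 \<le> int N * u + v" | "\<forall>\<^sub>F N in sequentially. int N * u + v < 0"
    using affine_sign_eventually by blast
  then show ?thesis
  proof cases
    case 1
    show ?thesis
    proof (cases m)
      \<comment> \<open>For m = 0 the function is the indicator of k = 0, which is not the
        restriction of a polynomial to k >= 0. The sign of k - 1 decides between k > 0 and k =
        0.\<close>
      case 0
      have "(\<forall>\<^sub>F N in sequentially. 0 \<le> int N * u + (v - 1)) \<or>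
        (\<forall>\<^sub>F N in sequentially. int N * u + (v - 1) < 0)" by (rule affine_sign_eventually)
      then show ?thesis
      proof
        assume "\<forall>\<^sub>F N in sequentially. 0 \<le> int N * u + (v - 1)"
        then have "\<forall>\<^sub>F N in sequentially. of_int (neg_binomial m (int N * u + v)) = (0::rat)"
          by eventually_elim (simp add: 0 neg_binomial_0)
        then show ?thesis by (rule evpoly_eventually_const)
      next
        assume "\<forall>\<^sub>F N in sequentially. int N * u + (v - 1) < 0"
        with 1 have "\<forall>\<^sub>F N in sequentially. of_int (neg_binomial m (int N * u + v)) = (1::rat)"
          by eventually_elim (simp add: 0 neg_binomial_0)
        then show ?thesis by (rule evpoly_eventually_const)
      qed
    next
      case (Suc n)
      obtain P :: "rat poly" where P: "\<And>k. of_nat ((k + n) choose n) = poly P (of_nat k)"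
        using binomial_polynomial[of n] by auto
      from 1 have "\<forall>\<^sub>F N in sequentially. of_int (neg_binomial m (int N * u + v)) =
          poly (pcompose P [:of_int v, of_int u:]) (of_nat N)"
      proof eventually_elim
        case (elim N)
        let ?k = "nat (int N * u + v)"
        have "of_int (neg_binomial m (int N * u + v)) = (of_nat ((?k + n) choose n) :: rat)"
          using elim binomial_symmetric[of ?k "?k + n"] by (simp add: neg_binomial_def Suc)
        also have "\<dots> = poly P (of_nat ?k)" by (rule P)
        also have "(of_nat ?k :: rat) = of_int (int N * u + v)" using elim by simp
        finally show ?case by (simp add: poly_pcompose add.commute)
      qed
      then show ?thesis by (rule evpolyI)
    qed
  next
    case 2
    then have "\<forall>\<^sub>F N in sequentially. of_int (neg_binomial m (int N * u + v)) = (0::rat)"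
      by eventually_elim simp
    then show ?thesis by (rule evpoly_eventually_const)
  qed
qed

section \<open>Fundamental solutions of products of differences\<close>

definition diff_prod :: "(nat \<times> nat) multiset \<Rightarrow> mpoly" where
  "diff_prod E = (\<Prod>(i, j)\<in>#E. var i - var j)"

lemma diff_prod_simps [simp]:
  "diff_prod {#} = 1"
  "diff_prod (add_mset (i, j) E) = (var i - var j) * diff_prod E"
  "diff_prod (E + F) = diff_prod E * diff_prod F"
  by (simp_all add: diff_prod_def)

definition ray_poly :: "((nat \<Rightarrow> int) \<Rightarrow> int) \<Rightarrow> bool" where
  "ray_poly K \<longleftrightarrow> (\<forall>\<mu> \<eta>. evpoly (\<lambda>N. of_int (K (\<lambda>i. int N * \<mu> i + \<eta> i))))"

text \<open>\<open>K\<close> is the coefficient function of an expansion of 1/D. The last clause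
  says that it involves only x_j with j < n, which leaves x_n free to be adjoined.\<close>

definition fundamental :: "nat \<Rightarrow> mpoly \<Rightarrow> ((nat \<Rightarrow> int) \<Rightarrow> int) \<Rightarrow> bool" where
  "fundamental n D K \<longleftrightarrow> act D K = delta \<and> tame K \<and> ray_poly K \<and>
     (\<forall>a. K a \<noteq> 0 \<longrightarrow> (\<forall>j\<ge>n. a j = 0))"

text \<open>A ray with nonzero direction eventually leaves the origin, and a ray with zero direction
  is constant.\<close>

lemma ray_poly_delta: "ray_poly delta"
  unfolding ray_poly_def
proof (intro allI)
  fix \<mu> \<eta> :: "nat \<Rightarrow> int"
  show "evpoly (\<lambda>N. of_int (delta (\<lambda>i. int N * \<mu> i + \<eta> i)))"
  proof (cases "\<forall>i. \<mu> i = 0")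
    case True
    then show ?thesis by (simp add: evpoly_const)
  next
    case False
    then obtain i where i: "\<mu> i \<noteq> 0" by auto
    have "\<forall>\<^sub>F N in sequentially. (of_int (delta (\<lambda>i. int N * \<mu> i + \<eta> i)) :: rat) = 0"
      using eventually_gt_at_top[of "nat \<bar>\<eta> i\<bar>"]
    proof eventually_elim
      case (elim N)
      have "int N * 1 \<le> int N * \<bar>\<mu> i\<bar>" using i by (intro mult_left_mono) auto
      moreover have "\<bar>int N * \<mu> i\<bar> = int N * \<bar>\<mu> i\<bar>" by (simp add: abs_mult)
      ultimately have "int N * \<mu> i + \<eta> i \<noteq> 0" using elim by linarith
      then have "(\<lambda>i. int N * \<mu> i + \<eta> i) \<noteq> (\<lambda>_. 0)" by metis
      then show ?case by (simp add: delta_def)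
    qed
    then show ?thesis by (rule evpoly_eventually_const)
  qed
qed

lemma fundamental_delta: "fundamental n 1 delta"
  by (auto simp: fundamental_def tame_delta ray_poly_delta) (auto simp: delta_def split: if_splits)

lemma fundamental_diff:
  assumes "fundamental n D K" "fundamental n D' K'" "act D'' (\<lambda>a. K a - K' a) = delta"
  shows "fundamental n D'' (\<lambda>a. K a - K' a)"
  unfolding fundamental_def
proof (intro conjI allI impI)
  show "tame (\<lambda>a. K a - K' a)" using assms by (auto simp: fundamental_def intro: tame_diff)
  show "ray_poly (\<lambda>a. K a - K' a)"
    using assms by (auto simp: fundamental_def ray_poly_def intro!: evpoly_diff)
  fix a j assume "K a - K' a \<noteq> 0" "n \<le> j"
  then have "K a \<noteq> 0 \<or> K' a \<noteq> 0" by auto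
  then show "a j = 0" using \<open>n \<le> j\<close> assms(1,2) unfolding fundamental_def by blast
qed (fact assms(3))

text \<open>
  For \<open>K\<close> not involving $x_n$, this is the product of \<open>K\<close> with $(x_i - x_n)^{-m}$, expanded in
  powers of $x_n/x_i$.
\<close>

definition extend :: "nat \<Rightarrow> nat \<Rightarrow> nat \<Rightarrow> ((nat \<Rightarrow> int) \<Rightarrow> int) \<Rightarrow> (nat \<Rightarrow> int) \<Rightarrow> int" where
  "extend n i m K a = neg_binomial m (a n) * K (a(i := a i + a n + int m, n := 0))"

text \<open>Lowering the exponent of x_i or that of x_n by 1 leads to the same argument of
  \<open>K\<close>, so only the two binomials differ, and their difference is given by
  \<open>neg_binomial_Suc\<close>.\<close>

lemma act_extend_Suc:
  assumes "i < n"
  shows "act (var i - var n) (extend n i (Suc m) K) = extend n i m K"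
proof
  fix a :: "nat \<Rightarrow> int"
  let ?b = "a(i := a i + a n + int m, n := 0)"
  have "extend n i (Suc m) K (a(i := a i - 1)) = neg_binomial (Suc m) (a n) * K ?b"
    using assms by (simp add: extend_def add.assoc[symmetric])
  moreover have "extend n i (Suc m) K (a(n := a n - 1)) = neg_binomial (Suc m) (a n - 1) * K ?b"
  proof -
    have "(a(n := a n - 1))(i := a i + (a n - 1) + int (Suc m), n := 0) = ?b"
      using assms by (auto simp: fun_eq_iff)
    then show ?thesis using assms by (simp add: extend_def)
  qed
  ultimately show "act (var i - var n) (extend n i (Suc m) K) a = extend n i m K a"
    by (simp only: act_diff act_var left_diff_distrib[symmetric] neg_binomial_Suc extend_def[of n i m])
qed

lemma fundamental_extend:
  assumes "i < n" and K: "fundamental n D K"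
  shows "fundamental (Suc n) (D * (var i - var n) ^ m) (extend n i m K)"
  unfolding fundamental_def
proof (intro conjI allI impI)
  have K_supp: "a j = 0" if "K a \<noteq> 0" "n \<le> j" for a j
    using K that unfolding fundamental_def by blast
  \<comment> \<open>The case of no factor at all: \<open>K\<close> already vanishes unless the
    exponent of x_n is 0.\<close>
  have K0: "extend n i 0 K = K"
  proof
    fix a
    show "extend n i 0 K a = K a"
    proof (cases "a n = 0")
      case True
      then have "a(n := 0) = a" by auto
      then show ?thesis using True by (simp add: extend_def neg_binomial_0)
    next
      case False
      then show ?thesis using K by (auto simp: extend_def neg_binomial_0 fundamental_def)
    qed
  qed
  have "act ((var i - var n) ^ m) (extend n i m K) = K"
    by (induction m) (simp_all add: K0 power_Suc2 act_mult act_extend_Suc[OF \<open>i < n\<close>] del: power_Suc)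
  then show "act (D * (var i - var n) ^ m) (extend n i m K) = delta"
    using K by (simp add: act_mult fundamental_def)
  show "tame (extend n i m K)"
    unfolding tame_def
  proof (intro allI impI)
    fix p q :: nat and a :: "nat \<Rightarrow> int"
    assume "p < q"
    let ?a = "\<lambda>k. a(p := a p + int k, q := a q - int k)"
    let ?b = "a(i := a i + a n + int m, n := 0)"
    \<comment> \<open>If q = n, the exponent of x_n becomes negative and the binomial is 0. If p =
      n, then q > n, and a nonzero exponent of x_q lies outside the support of \<open>K\<close>.
      Otherwise the change of exponents commutes with moving along the line, and tameness of
      \<open>K\<close> applies.\<close>
    consider "q = n" | "p = n" | "p \<noteq> n" "q \<noteq> n" by auto
    then show "\<forall>\<^sub>F k in sequentially. extend n i m K (?a k) = 0"
    proof cases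
      case 1
      show ?thesis using eventually_gt_at_top[of "nat \<bar>a n\<bar>"]
        by eventually_elim (use 1 in \<open>simp add: extend_def\<close>)
    next
      case 2
      show ?thesis using eventually_gt_at_top[of "nat \<bar>a q\<bar>"]
      proof eventually_elim
        case (elim k)
        have "((?a k)(i := ?a k i + ?a k n + int m, n := 0)) q \<noteq> 0"
          using elim 2 \<open>p < q\<close> \<open>i < n\<close> by auto
        then have "K ((?a k)(i := ?a k i + ?a k n + int m, n := 0)) = 0"
          using K_supp[of _ q] 2 \<open>p < q\<close> less_imp_le by blast
        then show ?case by (simp add: extend_def)
      qed
    next
      case 3
      have eq: "(?a k)(i := ?a k i + ?a k n + int m, n := 0) = ?b(p := ?b p + int k, q := ?b q - int k)"
        for k by (rule ext) (use 3 \<open>p < q\<close> \<open>i < n\<close> in simp)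
      have "\<forall>\<^sub>F k in sequentially. K (?b(p := ?b p + int k, q := ?b q - int k)) = 0"
        using K \<open>p < q\<close> tameD unfolding fundamental_def by blast
      then show ?thesis
        by eventually_elim (simp only: extend_def eq mult_zero_right)
    qed
  qed
  show "ray_poly (extend n i m K)"
    unfolding ray_poly_def
  proof (intro allI)
    fix \<mu> \<eta> :: "nat \<Rightarrow> int"
    \<comment> \<open>The change of exponents in \<open>extend\<close> is affine, so it maps rays to
      rays.\<close>
    let ?\<mu> = "\<mu>(i := \<mu> i + \<mu> n, n := 0)" and ?\<eta> = "\<eta>(i := \<eta> i + \<eta> n + int m, n := 0)"
    have "extend n i m K (\<lambda>i. int N * \<mu> i + \<eta> i) =
        neg_binomial m (int N * \<mu> n + \<eta> n) * K (\<lambda>i. int N * ?\<mu> i + ?\<eta> i)" for N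
    proof -
      have "(\<lambda>i. int N * \<mu> i + \<eta> i)(i := int N * \<mu> i + \<eta> i + (int N * \<mu> n + \<eta> n) + int m, n := 0)
          = (\<lambda>i. int N * ?\<mu> i + ?\<eta> i)" by (rule ext) (simp add: distrib_left)
      then show ?thesis by (simp add: extend_def)
    qed
    moreover have "evpoly (\<lambda>N. of_int (K (\<lambda>i. int N * ?\<mu> i + ?\<eta> i)))"
      using K unfolding fundamental_def ray_poly_def by blast
    ultimately show "evpoly (\<lambda>N. of_int (extend n i m K (\<lambda>i. int N * \<mu> i + \<eta> i)))"
      using evpoly_mult[OF evpoly_neg_binomial] by simp
  qed
  fix a j assume "extend n i m K a \<noteq> 0" "Suc n \<le> j"
  then have "K (a(i := a i + a n + int m, n := 0)) \<noteq> 0" by (auto simp: extend_def)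
  then have "(a(i := a i + a n + int m, n := 0)) j = 0"
    using K_supp \<open>Suc n \<le> j\<close> Suc_leD by blast
  then show "a j = 0" using \<open>i < n\<close> \<open>Suc n \<le> j\<close> by (auto split: if_splits)
qed

lemma fundamental_mono:
  assumes "fundamental n D K" "n \<le> n'"
  shows "fundamental n' D K"
  using assms(1) order_trans[OF assms(2)] unfolding fundamental_def by blast

text \<open>
  The partial fraction decomposition $1/(yz) = 1/(xy) - 1/(xz)$ for $x = x_i - x_j$,
  $y = x_j - x_k$, $z = x_i - x_k$, where $x = z - y$.
\<close>

lemma fundamental_triangle:
  assumes "i < j"
    and K: "fundamental n (D * ((var i - var j) * (var j - var k))) K"
    and K': "fundamental n (D * ((var i - var j) * (var i - var k))) K'"
  shows "fundamental n (D * ((var i - var k) * (var j - var k))) (\<lambda>a. K a - K' a)"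
proof (rule fundamental_diff[OF K K'])
  let ?x = "var i - var j" and ?y = "var j - var k" and ?z = "var i - var k"
  let ?L = "act (D * (?z * ?y)) (\<lambda>a. K a - K' a)"
  \<comment> \<open>Partial fractions only show that \<open>?L\<close> and \<open>delta\<close>
    agree after multiplication by x_i - x_j; tameness then removes this factor.\<close>
  have "act ?x ?L = act (?x * (D * (?z * ?y))) (\<lambda>a. K a - K' a)" by (simp add: act_mult)
  also have "\<dots> = (\<lambda>a. act (?x * (D * (?z * ?y))) K a - act (?x * (D * (?z * ?y))) K' a)"
    by (rule ext) (rule act_diff_right)
  also have "?x * (D * (?z * ?y)) = ?z * (D * (?x * ?y))" by (simp only: mult.left_commute)
  also have "act \<dots> K = act ?z delta" using K by (simp add: act_mult[of ?z] fundamental_def)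
  also have "?z * (D * (?x * ?y)) = ?y * (D * (?x * ?z))" by (simp only: ac_simps)
  also have "act \<dots> K' = act ?y delta" using K' by (simp add: act_mult[of ?y] fundamental_def)
  also have "(\<lambda>a. act ?z delta a - act ?y delta a) = act ?x delta"
    by (rule ext) (simp add: act_diff)
  finally have "act ?x ?L = act ?x delta" .
  moreover have "tame ?L" using K K' by (intro tame_act tame_diff) (simp_all add: fundamental_def)
  ultimately show "?L = delta" using tame_delta \<open>i < j\<close> by (metis tame_cancel)
qed

text \<open>Induction on n eliminates the last variable x_n. \<open>S\<close> lists the indices i of
  the factors x_i - x_n. While it contains two distinct indices i < j, the triangle identity trades
  one of their factors for x_i - x_j, which is free of x_n, so \<open>S\<close> shrinks. Once all
  indices agree, \<open>extend\<close> inverts the remaining power in one go.\<close>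

lemma fundamental_exists:
  assumes "\<And>i j. (i, j) \<in># E \<Longrightarrow> i < j \<and> j < n"
  shows "\<exists>K. fundamental n (diff_prod E) K"
  using assms
proof (induction n arbitrary: E)
  case 0
  then have "E = {#}" by (metis not_less_zero multiset_nonemptyE surj_pair)
  then show ?case using fundamental_delta by auto
next
  case (Suc n)
  have inner: "\<exists>K. fundamental (Suc n) (diff_prod (E + image_mset (\<lambda>i. (i, n)) S)) K"
    if "\<And>i j. (i, j) \<in># E \<Longrightarrow> i < j \<and> j < n" "\<And>i. i \<in># S \<Longrightarrow> i < n" for E S
    using that
  proof (induction "size S" arbitrary: E S rule: less_induct)
    case less
    show ?case
    proof (cases "\<exists>i j S'. S = add_mset i (add_mset j S') \<and> i < j")
      case True
      then obtain i j S' where S: "S = add_mset i (add_mset j S')" and "i < j" by blast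
      let ?D = "diff_prod (E + image_mset (\<lambda>i. (i, n)) S')"
      \<comment> \<open>\<open>l\<close> is the index that keeps its factor with x_n; the factor of
        the other index is traded for x_i - x_j.\<close>
      have "\<exists>K. fundamental (Suc n)
          (diff_prod (add_mset (i, j) E + image_mset (\<lambda>i. (i, n)) (add_mset l S'))) K"
        if "l \<in> {i, j}" for l
        by (rule less(1)) (use less(2,3) \<open>i < j\<close> that in \<open>auto simp: S\<close>)
      from this[of j] this[of i] obtain K K' where
        "fundamental (Suc n) (?D * ((var i - var j) * (var j - var n))) K"
        "fundamental (Suc n) (?D * ((var i - var j) * (var i - var n))) K'"
        by (auto simp: ac_simps)
      from fundamental_triangle[OF \<open>i < j\<close> this] show ?thesis
        by (auto simp: S ac_simps)
    next
      case False
      obtain K where K: "fundamental n (diff_prod E) K" using Suc.IH less(2) by blast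
      show ?thesis
      proof (cases "S = {#}")
        case True
        then show ?thesis using fundamental_mono[OF K, of "Suc n"] by auto
      next
        case nonempty: False
        then obtain i S1 where S1: "S = add_mset i S1" by (meson multiset_cases)
        have "j = i" if j: "j \<in># S1" for j
        proof -
          obtain S2 where "S1 = add_mset j S2" using multi_member_split[OF j] by blast
          then have "S = add_mset i (add_mset j S2)" "S = add_mset j (add_mset i S2)"
            using S1 by auto
          then show ?thesis using False by (metis linorder_neqE_nat)
        qed
        then have "S1 = replicate_mset (size S1) i"
          by (intro set_mset_subset_singletonD) auto
        then obtain m where S: "S = replicate_mset m i" "m > 0"
          using S1 by (metis replicate_mset_Suc zero_less_Suc)
        have "i < n" using S1 less(3) by auto
        have "diff_prod (image_mset (\<lambda>i. (i, n)) S) = (var i - var n) ^ m"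
          unfolding S(1) by (induction m) auto
        then show ?thesis using fundamental_extend[OF \<open>i < n\<close> K, of m] by auto
      qed
    qed
  qed
  \<comment> \<open>Second indices are at most n, so the factors split into those free of x_n and
    those of the form x_i - x_n.\<close>
  let ?E = "filter_mset (\<lambda>e. snd e < n) E" and ?F = "filter_mset (\<lambda>e. \<not> snd e < n) E"
  have "(fst e, n) = e" if "e \<in># ?F" for e
    using that Suc.prems[of "fst e" "snd e"] by (cases e) auto
  then have "image_mset (\<lambda>e. (fst e, n)) ?F = image_mset id ?F"
    by (intro image_mset_cong) simp
  then have "image_mset (\<lambda>i. (i, n)) (image_mset fst ?F) = ?F"
    by (simp add: multiset.map_comp o_def)
  moreover have "\<exists>K. fundamental (Suc n)
      (diff_prod (?E + image_mset (\<lambda>i. (i, n)) (image_mset fst ?F))) K"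
  proof (rule inner)
    show "i < j \<and> j < n" if "(i, j) \<in># ?E" for i j using that Suc.prems[of i j] by auto
    show "i < n" if "i \<in># image_mset fst ?F" for i
      using that Suc.prems by fastforce
  qed
  moreover have "?E + ?F = E" by simp
  ultimately show ?case by simp
qed

text \<open>Exchanging variables may produce factors x_i - x_j with i > j, and reversing one costs a
  sign. The sign \<open>c\<close> is recorded through \<open>c * c = 1\<close>, so that it serves as
  its own inverse.\<close>

lemma diff_prod_ordered:
  assumes "\<And>i j. (i, j) \<in># E \<Longrightarrow> i \<noteq> j"
  shows "\<exists>E' n c. (\<forall>(i, j)\<in>#E'. i < j \<and> j < n) \<and> c * c = 1 \<and> diff_prod E = c * diff_prod E'"
  using assms
proof (induction E)
  case empty
  show ?case by (rule exI[of _ "{#}"]) (auto intro!: exI[of _ "1 :: mpoly"])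
next
  case (add e E)
  obtain E' n c where E': "\<forall>(i, j)\<in>#E'. i < j \<and> j < n" "c * c = 1" "diff_prod E = c * diff_prod E'"
    using add by auto
  obtain i j where e: "e = (i, j)" by (cases e)
  let ?n = "Suc (max n (max i j))"
  consider "i < j" | "j < i" using add.prems[of i j] e by fastforce
  then show ?case
  proof cases
    case 1
    show ?thesis
      by (rule exI[of _ "add_mset (i, j) E'"], rule exI[of _ ?n], rule exI[of _ c])
        (use E' 1 in \<open>auto simp: e\<close>)
  next
    case 2
    show ?thesis
      by (rule exI[of _ "add_mset (j, i) E'"], rule exI[of _ ?n], rule exI[of _ "- c"])
        (use E' 2 in \<open>auto simp: e algebra_simps\<close>)
  qed
qed

lemma ray_poly_act:
  assumes "ray_poly K"
  shows "ray_poly (act p K)"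
  unfolding ray_poly_def
proof (intro allI)
  fix \<mu> \<eta> :: "nat \<Rightarrow> int"
  have "evpoly (\<lambda>N. of_int (K (\<lambda>i. int N * \<mu> i + (\<eta> i - int (Poly_Mapping.lookup b i)))))" for b
    using assms[unfolded ray_poly_def, rule_format, of \<mu> "\<lambda>i. \<eta> i - int (Poly_Mapping.lookup b i)"] .
  then show "evpoly (\<lambda>N. of_int (act p K (\<lambda>i. int N * \<mu> i + \<eta> i)))"
    unfolding act_def by (auto simp: add_diff_eq intro!: evpoly_sum evpoly_mult evpoly_const)
qed

lemma fundamental_solution:
  assumes "\<And>i j. (i, j) \<in># E \<Longrightarrow> i \<noteq> j"
  obtains K where "act (diff_prod E) K = delta" "ray_poly K"
proof -
  obtain E' n c where E': "\<forall>(i, j)\<in>#E'. i < j \<and> j < n" "c * c = 1" "diff_prod E = c * diff_prod E'"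
    using diff_prod_ordered assms by blast
  obtain K where K: "fundamental n (diff_prod E') K"
    using fundamental_exists[of E' n] E'(1) by fast
  have "act (diff_prod E) (act c K) = act (c * c * diff_prod E') K"
    unfolding E'(3) act_mult[symmetric] by (simp only: ac_simps)
  also have "\<dots> = delta" using K E'(2) by (simp add: fundamental_def)
  finally show ?thesis
    using that K ray_poly_act by (auto simp: fundamental_def)
qed

section \<open>Divided differences\<close>

lemma swap_vars_add: "swap_vars i (f + g) = swap_vars i f + swap_vars i g"
  by (rule poly_mapping_eqI) (simp add: lookup_swap_vars lookup_add)

lemma swap_vars_diff: "swap_vars i (f - g) = swap_vars i f - swap_vars i g"
  by (rule poly_mapping_eqI) (simp add: lookup_swap_vars lookup_minus)

lemma swap_vars_single:
  "swap_vars i (Poly_Mapping.single e c) = Poly_Mapping.single (swap_exponents i e) c"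
  by (rule poly_mapping_eqI)
    (metis lookup_single_eq lookup_single_not_eq lookup_swap_vars swap_exponents_involutory)

lemma swap_exponents_add: "swap_exponents i (d + e) = swap_exponents i d + swap_exponents i e"
  by (rule poly_mapping_eqI) (simp add: lookup_swap_exponents lookup_add)

lemma swap_exponents_single:
  "swap_exponents i (Poly_Mapping.single k n) = Poly_Mapping.single (transpose i (Suc i) k) n"
  by (rule poly_mapping_eqI)
    (auto simp: lookup_swap_exponents lookup_single when_def transpose_def)

lemma swap_vars_mult: "swap_vars i (f * g) = swap_vars i f * swap_vars i g"
proof (induction f rule: mpoly_induct)
  case (single d a)
  show ?case
  proof (induction g rule: mpoly_induct)
    case (single e b)
    show ?case by (simp add: mult_single swap_vars_single swap_exponents_add)
  next
    case (add p q)
    then show ?case by (simp add: distrib_left swap_vars_add)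
  qed
next
  case (add p q)
  then show ?case by (simp add: distrib_right swap_vars_add)
qed

lemma swap_vars_1 [simp]: "swap_vars i 1 = 1"
proof -
  have "swap_exponents i 0 = 0" by (rule poly_mapping_eqI) (simp add: lookup_swap_exponents)
  then show ?thesis by (metis single_one swap_vars_single)
qed

lemma swap_vars_var: "swap_vars i (var k) = var (transpose i (Suc i) k)"
  by (simp add: var_def swap_vars_single swap_exponents_single)

lemma swap_vars_involutory [simp]: "swap_vars i (swap_vars i f) = f"
  by (rule poly_mapping_eqI) (simp add: lookup_swap_vars swap_exponents_involutory)

lemma swap_vars_commute:
  assumes "Suc i < j"
  shows "swap_vars i (swap_vars j f) = swap_vars j (swap_vars i f)"
proof -
  have "swap_exponents j (swap_exponents i e) = swap_exponents i (swap_exponents j e)" for e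
    by (rule poly_mapping_eqI, simp only: lookup_swap_exponents,
        rule arg_cong[where f = "Poly_Mapping.lookup e"])
      (use assms in \<open>auto simp: transpose_def\<close>)
  then show ?thesis by (intro poly_mapping_eqI) (simp add: lookup_swap_vars)
qed

lemma swap_vars_braid:
  "swap_vars i (swap_vars (Suc i) (swap_vars i f)) =
   swap_vars (Suc i) (swap_vars i (swap_vars (Suc i) f))"
proof -
  have "swap_exponents i (swap_exponents (Suc i) (swap_exponents i e)) =
      swap_exponents (Suc i) (swap_exponents i (swap_exponents (Suc i) e))" for e
    by (rule poly_mapping_eqI, simp only: lookup_swap_exponents,
        rule arg_cong[where f = "Poly_Mapping.lookup e"])
      (auto simp: transpose_def)
  then show ?thesis by (intro poly_mapping_eqI) (simp add: lookup_swap_vars)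
qed

section \<open>Homogeneous polynomials\<close>

definition mdeg :: "(nat \<Rightarrow>\<^sub>0 nat) \<Rightarrow> nat" where
  "mdeg e = Sum_any (Poly_Mapping.lookup e)"

definition homog :: "nat \<Rightarrow> mpoly \<Rightarrow> bool" where
  "homog d f \<longleftrightarrow> (\<forall>e\<in>Poly_Mapping.keys f. mdeg e = d)"

lemma mdeg_add: "mdeg (d + e) = mdeg d + mdeg e"
  by (simp add: mdeg_def lookup_add Sum_any.distrib)

lemma mdeg_single [simp]: "mdeg (Poly_Mapping.single k n) = n"
  by (simp add: mdeg_def lookup_single)

lemma homog_0 [simp]: "homog d 0"
  by (simp add: homog_def)

lemma homog_single: "mdeg e = d \<Longrightarrow> homog d (Poly_Mapping.single e c)"
  by (simp add: homog_def)

lemma homog_1: "homog 0 1"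
  by (simp add: homog_def mdeg_def)

lemma homog_add: "homog d f \<Longrightarrow> homog d g \<Longrightarrow> homog d (f + g)"
  using keys_add[of f g] by (auto simp: homog_def)

lemma homog_uminus: "homog d f \<Longrightarrow> homog d (- f)"
  by (auto simp: homog_def in_keys_iff)

lemma homog_sum: "(\<And>x. x \<in> S \<Longrightarrow> homog d (f x)) \<Longrightarrow> homog d (sum f S)"
  by (induction S rule: infinite_finite_induct) (auto intro: homog_add)

lemma homog_mult: "homog d f \<Longrightarrow> homog e g \<Longrightarrow> homog (d + e) (f * g)"
  using keys_mult[of f g] by (fastforce simp: homog_def mdeg_add)

lemma homog_prod: "(\<And>x. x \<in> S \<Longrightarrow> homog (d x) (f x)) \<Longrightarrow> homog (sum d S) (prod f S)"
  by (induction S rule: infinite_finite_induct) (auto intro: homog_mult homog_1)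

lemma homog_var: "homog 1 (var i)"
  by (simp add: homog_single var_def)

lemma homog_var_power: "homog n (var i ^ n)"
  using homog_prod[of "{..<n}" "\<lambda>_. 1" "\<lambda>_. var i"] homog_var by simp

lemma var_power: "var i ^ n = Poly_Mapping.single (Poly_Mapping.single i n) 1"
  by (induction n) (simp_all add: var_def mult_single single_add[symmetric])

text \<open>The monomial is M u^n, where M is symmetric in x_i and x_(i+1) and u is one of them. The
  quotient comes from the factorization of u^n - v^n, which also shows that the degree drops by
  1.\<close>

lemma divided_monomial:
  "\<exists>g. (var i - var (Suc i)) * g = Poly_Mapping.single e c - swap_vars i (Poly_Mapping.single e c)
     \<and> (\<forall>d. mdeg e = Suc d \<longrightarrow> homog d g)"
proof -
  let ?x = "var i" and ?y = "var (Suc i)"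
  let ?a = "Poly_Mapping.lookup e i" and ?b = "Poly_Mapping.lookup e (Suc i)"
  \<comment> \<open>\<open>?k\<close> is the variable with the larger exponent and \<open>?n\<close>
    the excess; removing it leaves equal exponents, hence a symmetric monomial.\<close>
  let ?n = "max ?a ?b - min ?a ?b" and ?k = "if ?b \<le> ?a then i else Suc i"
  define d where "d = e - Poly_Mapping.single ?k ?n"
  have e: "e = d + Poly_Mapping.single ?k ?n"
    by (rule poly_mapping_eqI)
      (auto simp: d_def lookup_add lookup_minus lookup_single when_def)
  have d: "swap_exponents i d = d"
    by (rule poly_mapping_eqI)
      (auto simp: d_def lookup_swap_exponents lookup_minus lookup_single when_def transpose_def)
  define M where "M = Poly_Mapping.single d c"
  define q where "q = M * (\<Sum>l<?n. ?y ^ (?n - Suc l) * ?x ^ l)"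
  have M: "swap_vars i M = M" by (simp add: M_def swap_vars_single d)
  have q: "(?x - ?y) * q = M * (?x ^ ?n - ?y ^ ?n)"
    unfolding q_def power_diff_sumr2[of ?x ?n ?y] by (simp only: ac_simps)
  have f: "Poly_Mapping.single e c = M * var ?k ^ ?n"
    unfolding M_def var_power mult_single by (simp flip: e)
  have sf: "swap_vars i (Poly_Mapping.single e c) = M * var (if ?b \<le> ?a then Suc i else i) ^ ?n"
    unfolding f swap_vars_mult M var_power swap_vars_single swap_exponents_single by simp
  have hom: "homog m q" if "mdeg e = Suc m" for m
  proof (cases "?n = 0")
    case True
    then show ?thesis unfolding q_def by simp
  next
    case False
    have "homog (?n - 1) (?y ^ (?n - Suc l) * ?x ^ l)" if "l < ?n" for l
    proof -
      have "?n - Suc l + l = ?n - 1" using that by arith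
      then show ?thesis using homog_mult[OF homog_var_power homog_var_power, of "?n - Suc l"] by metis
    qed
    then have "homog (?n - 1) (\<Sum>l<?n. ?y ^ (?n - Suc l) * ?x ^ l)"
      by (intro homog_sum) blast
    then have "homog (mdeg d + (?n - 1)) q" unfolding q_def M_def
      by (intro homog_mult homog_single) simp_all
    moreover have "mdeg e = mdeg d + ?n"
      using mdeg_add[of d "Poly_Mapping.single ?k ?n"] unfolding e[symmetric] mdeg_single .
    then have "mdeg d + (?n - 1) = m" using that False by linarith
    ultimately show ?thesis by simp
  qed
  show ?thesis
  proof (cases "?b \<le> ?a")
    case True
    then show ?thesis using q hom unfolding sf unfolding f
      by (intro exI[of _ q]) (simp add: right_diff_distrib)
  next
    case False
    then show ?thesis using q hom homog_uminus unfolding sf unfolding f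
      by (intro exI[of _ "- q"]) (simp add: right_diff_distrib)
  qed
qed

text \<open>Divisibility passes from monomials to sums, so the definite description in
  \<open>divided_difference\<close> always denotes the exact quotient.\<close>

lemma divided_difference_mult:
  "(var i - var (Suc i)) * divided_difference i f = f - swap_vars i f"
proof -
  have "\<exists>g. (var i - var (Suc i)) * g = f - swap_vars i f"
  proof (induction f rule: mpoly_induct)
    case (single e c)
    show ?case using divided_monomial[of i e c] by (elim exE conjE) (rule exI)
  next
    case (add p q)
    then obtain g h where "(var i - var (Suc i)) * g = p - swap_vars i p"
      "(var i - var (Suc i)) * h = q - swap_vars i q" by blast
    then have "(var i - var (Suc i)) * (g + h) = p + q - swap_vars i (p + q)"
      by (simp add: distrib_left swap_vars_add)
    then show ?case by (rule exI)
  qed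
  then obtain g where g: "(var i - var (Suc i)) * g = f - swap_vars i f" ..
  show ?thesis unfolding divided_difference_eqI[OF g] by (rule g)
qed

lemma sum_monomials: "f = (\<Sum>e\<in>Poly_Mapping.keys f. Poly_Mapping.single e (Poly_Mapping.lookup f e))"
  by (rule poly_mapping_eqI) (simp add: lookup_sum lookup_single when_def in_keys_iff)

lemma swap_vars_sum: "swap_vars i (sum f S) = (\<Sum>x\<in>S. swap_vars i (f x))"
proof (induction S rule: infinite_finite_induct)
  have "swap_vars i 0 = 0" using swap_vars_diff[of i 0 0] by simp
  then show "swap_vars i (sum f A) = (\<Sum>x\<in>A. swap_vars i (f x))" if "infinite A" for A
    using that by simp
  from \<open>swap_vars i 0 = 0\<close> show "swap_vars i (sum f {}) = (\<Sum>x\<in>{}. swap_vars i (f x))" by simp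
qed (simp add: swap_vars_add)

text \<open>The quotients of the single monomials are homogeneous, and by uniqueness of the quotient
  they add up to the divided difference of \<open>f\<close>.\<close>

lemma homog_divided_difference:
  assumes "homog (Suc d) f"
  shows "homog d (divided_difference i f)"
proof -
  let ?m = "\<lambda>e. Poly_Mapping.single e (Poly_Mapping.lookup f e)"
  obtain g where g: "\<And>e. (var i - var (Suc i)) * g e = ?m e - swap_vars i (?m e)"
    "\<And>e d. mdeg e = Suc d \<Longrightarrow> homog d (g e)"
  proof -
    have "\<forall>e. \<exists>g. (var i - var (Suc i)) * g = ?m e - swap_vars i (?m e) \<and>
        (\<forall>d. mdeg e = Suc d \<longrightarrow> homog d g)" using divided_monomial by blast
    from choice[OF this] show ?thesis using that by blast
  qed
  have "(var i - var (Suc i)) * (\<Sum>e\<in>Poly_Mapping.keys f. g e) =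
      (\<Sum>e\<in>Poly_Mapping.keys f. ?m e) - swap_vars i (\<Sum>e\<in>Poly_Mapping.keys f. ?m e)"
    by (simp add: sum_distrib_left g sum_subtractf swap_vars_sum)
  then have "divided_difference i f = (\<Sum>e\<in>Poly_Mapping.keys f. g e)"
    by (intro divided_difference_eqI) (simp only: sum_monomials[symmetric])
  moreover have "homog d (\<Sum>e\<in>Poly_Mapping.keys f. g e)"
  proof (rule homog_sum)
    fix e assume "e \<in> Poly_Mapping.keys f"
    then have "mdeg e = Suc d" using assms by (simp add: homog_def)
    then show "homog d (g e)" by (rule g(2))
  qed
  ultimately show ?thesis by simp
qed

section \<open>Commutation and braid relations\<close>

lemma var_diff_nonzero: "i \<noteq> j \<Longrightarrow> var i - var j \<noteq> 0"
  using var_neq by simp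

text \<open>The two exchanges commute and each fixes the linear form of the other, so multiplying
  either side by both forms gives the same alternating sum of four terms.\<close>

lemma divided_difference_commute:
  assumes "Suc i < j"
  shows "divided_difference i (divided_difference j f) =
    divided_difference j (divided_difference i f)"
proof -
  let ?X = "var i - var (Suc i)" and ?Y = "var j - var (Suc j)"
  let ?s = "swap_vars i" and ?t = "swap_vars j"
  let ?D = "divided_difference i" and ?E = "divided_difference j"
  have sY: "?s ?Y = ?Y" and tX: "?t ?X = ?X"
    using assms by (auto simp: swap_vars_diff swap_vars_var transpose_def)
  have "?Y * (?X * ?D (?E f)) = ?Y * ?E f - ?s (?Y * ?E f)"
    unfolding divided_difference_mult[of i] right_diff_distrib swap_vars_mult sY ..
  also have "\<dots> = f - ?t f - ?s f + ?s (?t f)"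
    by (simp add: divided_difference_mult swap_vars_diff)
  also have "\<dots> = ?X * ?D f - ?t (?X * ?D f)"
    by (simp add: divided_difference_mult swap_vars_diff swap_vars_commute[OF assms])
  also have "\<dots> = ?X * (?Y * ?E (?D f))"
    unfolding divided_difference_mult[of j] right_diff_distrib swap_vars_mult tX ..
  finally have "(?X * ?Y) * ?D (?E f) = (?X * ?Y) * ?E (?D f)" by (simp only: ac_simps)
  moreover have "?X * ?Y \<noteq> 0" using var_diff_nonzero by simp
  ultimately show ?thesis by (metis mult_left_cancel)
qed

text \<open>With reflections s, t and their roots X, Y, \<open>k\<close> is a triple divided
  difference of \<open>f\<close>, and the right side is the alternating sum over S_3. The abstract
  form allows the two reflections to exchange roles.\<close>

lemma triple_divided_difference:
  fixes X Y :: mpoly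
  assumes s: "\<And>f g. s (f * g) = s f * s g" "\<And>f g. s (f - g) = s f - s g"
    and t: "\<And>f g. t (f * g) = t f * t g" "\<And>f g. t (f - g) = t f - t g"
    and inv: "s (s f) = f"
    and roots: "s X = - X" "s Y = X + Y" "s (X + Y) = Y" "t X = X + Y"
    and g: "X * g = f - s f" and h: "Y * h = g - t g" and k: "X * k = h - s h"
    and "X \<noteq> 0"
  shows "X * Y * (X + Y) * k = f - s f - t f + t (s f) + s (t f) - s (t (s f))"
proof -
  let ?Z = "X + Y"
  have sZh: "X * Y * ?Z * h = ?Z * (f - s f) - X * (t f - t (s f))"
  proof -
    have "X * Y * ?Z * h = X * ?Z * (Y * h)" by (simp only: ac_simps)
    also have "\<dots> = ?Z * (X * g) - X * (t X * t g)"
      unfolding h by (simp add: right_diff_distrib roots ac_simps)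
    finally show ?thesis by (simp only: t(1)[symmetric] g t(2))
  qed
  \<comment> \<open>The term with \<open>s h\<close> is obtained by applying \<open>s\<close> to
    \<open>sZh\<close>, since \<open>s\<close> negates X * Y * (X + Y).\<close>
  have "X * (X * Y * ?Z * k) = X * Y * ?Z * (X * k)" by (simp only: ac_simps)
  also have "\<dots> = X * Y * ?Z * h - X * Y * ?Z * s h" by (simp only: k right_diff_distrib)
  also have "X * Y * ?Z * s h = - s (X * Y * ?Z * h)"
    unfolding s(1) roots by (simp add: ac_simps)
  also have "X * Y * ?Z * h - - s (X * Y * ?Z * h) =
      ?Z * (f - s f) - X * (t f - t (s f)) + (s ?Z * (s f - f) - s X * (s (t f) - s (t (s f))))"
    by (simp only: sZh s inv) simp
  also have "\<dots> = X * (f - s f - t f + t (s f) + s (t f) - s (t (s f)))"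
    unfolding roots by (simp add: algebra_simps)
  finally show ?thesis using \<open>X \<noteq> 0\<close> by (metis mult_left_cancel)
qed

text \<open>Multiplied by the three roots, both sides become the alternating sum over S_3; their
  last terms agree by the braid relation of the exchanges.\<close>

lemma divided_difference_braid:
  "divided_difference i (divided_difference (Suc i) (divided_difference i f)) =
   divided_difference (Suc i) (divided_difference i (divided_difference (Suc i) f))"
proof -
  let ?X = "var i - var (Suc i)" and ?Y = "var (Suc i) - var (Suc (Suc i))"
  have X: "?X \<noteq> 0" and Y: "?Y \<noteq> 0" by (simp_all add: var_neq)
  have "?X + ?Y = var i - var (Suc (Suc i))" by simp
  then have Z: "?X + ?Y \<noteq> 0" by (simp add: var_neq)
  let ?s = "swap_vars i" and ?t = "swap_vars (Suc i)"
  let ?D = "divided_difference i" and ?E = "divided_difference (Suc i)"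
  note roots = swap_vars_diff swap_vars_add swap_vars_var transpose_def
  have "?X * ?Y * (?X + ?Y) * ?D (?E (?D f)) =
      f - ?s f - ?t f + ?t (?s f) + ?s (?t f) - ?s (?t (?s f))"
  proof (rule triple_divided_difference[where s = ?s and t = ?t and X = ?X and Y = ?Y
        and f = f and g = "?D f" and h = "?E (?D f)" and k = "?D (?E (?D f))"])
    show "?s ?X = - ?X" "?s ?Y = ?X + ?Y" "?s (?X + ?Y) = ?Y" "?t ?X = ?X + ?Y"
      by (simp_all add: roots)
  qed (rule swap_vars_mult swap_vars_diff swap_vars_involutory divided_difference_mult X)+
  moreover have "?Y * ?X * (?Y + ?X) * ?E (?D (?E f)) =
      f - ?t f - ?s f + ?s (?t f) + ?t (?s f) - ?t (?s (?t f))"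
  proof (rule triple_divided_difference[where s = ?t and t = ?s and X = ?Y and Y = ?X
        and f = f and g = "?E f" and h = "?D (?E f)" and k = "?E (?D (?E f))"])
    show "?t ?Y = - ?Y" "?t ?X = ?Y + ?X" "?t (?Y + ?X) = ?X" "?s ?Y = ?Y + ?X"
      by (simp_all add: roots)
  qed (rule swap_vars_mult swap_vars_diff swap_vars_involutory divided_difference_mult Y)+
  ultimately have "?X * ?Y * (?X + ?Y) * ?D (?E (?D f)) = ?Y * ?X * (?Y + ?X) * ?E (?D (?E f))"
    unfolding swap_vars_braid by (simp only:) simp
  also have "?Y * ?X * (?Y + ?X) = ?X * ?Y * (?X + ?Y)" by (simp only: ac_simps)
  finally have "?X * ?Y * (?X + ?Y) * ?D (?E (?D f)) = ?X * ?Y * (?X + ?Y) * ?E (?D (?E f))" .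
  moreover have "?X * ?Y * (?X + ?Y) \<noteq> 0" using X Y Z by (simp only: mult_eq_0_iff) blast
  ultimately show ?thesis by (rule mult_left_cancel[THEN iffD1, rotated])
qed

section \<open>Rational expansions along rays\<close>

text \<open>Negative entries are truncated to exponent 0, so multiplying such monomials adds
  exponent vectors only under nonnegativity.\<close>

definition exp_mono :: "nat \<Rightarrow> (nat \<Rightarrow> int) \<Rightarrow> mpoly" where
  "exp_mono h a = Poly_Mapping.single (monomial_exponent h a) 1"

lemma lookup_monomial_exponent:
  "Poly_Mapping.lookup (monomial_exponent h a) k = (if k \<in> {1..h} then nat (a k) else 0)"
proof -
  have "Poly_Mapping.lookup (monomial_exponent h a) k = (\<Sum>i\<in>{1..h}. if i = k then nat (a i) else 0)"
    by (simp add: monomial_exponent_def lookup_sum lookup_single when_def)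
  also have "\<dots> = (if k \<in> {1..h} then nat (a k) else 0)" by (rule sum.delta) simp
  finally show ?thesis .
qed

lemma exp_mono_mult:
  assumes "\<And>i. i \<in> {1..h} \<Longrightarrow> 0 \<le> a i" "\<And>i. i \<in> {1..h} \<Longrightarrow> 0 \<le> b i"
  shows "exp_mono h a * exp_mono h b = exp_mono h (\<lambda>i. a i + b i)"
proof -
  have "monomial_exponent h a + monomial_exponent h b = monomial_exponent h (\<lambda>i. a i + b i)"
    by (rule poly_mapping_eqI)
      (use assms in \<open>auto simp: lookup_add lookup_monomial_exponent nat_add_distrib\<close>)
  then show ?thesis by (simp add: exp_mono_def mult_single)
qed

lemma exp_mono_eq_prod: "exp_mono h a = (\<Prod>i\<in>{1..h}. var i ^ nat (a i))"
proof -
  have "(\<Prod>i\<in>S. var i ^ nat (a i)) =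
      Poly_Mapping.single (\<Sum>i\<in>S. Poly_Mapping.single i (nat (a i))) 1" if "finite S" for S
    using that by induction (simp_all add: var_power mult_single)
  then show ?thesis by (simp add: exp_mono_def monomial_exponent_def)
qed

lemma swap_vars_exp_mono:
  assumes "1 \<le> i" "i < h"
  shows "swap_vars i (exp_mono h a) = exp_mono h (a \<circ> transpose i (Suc i))"
proof -
  have "swap_exponents i (monomial_exponent h a) = monomial_exponent h (a \<circ> transpose i (Suc i))"
    by (rule poly_mapping_eqI)
      (use assms in \<open>auto simp: lookup_swap_exponents lookup_monomial_exponent transpose_def\<close>)
  then show ?thesis by (simp add: exp_mono_def swap_vars_single)
qed

section \<open>Sums of monomials moving along rays\<close>

definition nonneg_ray :: "nat \<Rightarrow> (nat \<Rightarrow> nat) \<Rightarrow> (nat \<Rightarrow> int) \<Rightarrow> bool" where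
  "nonneg_ray h \<alpha> \<beta> \<longleftrightarrow> (\<forall>\<^sub>F N in sequentially. \<forall>i\<in>{1..h}. 0 \<le> ray \<alpha> \<beta> N i)"

text \<open>The coefficient \<open>c\<close> is a polynomial independent of N. Eventual equality is
  built in because rays need only be nonnegative for large N.\<close>

inductive ray_sum :: "nat \<Rightarrow> (nat \<Rightarrow> mpoly) \<Rightarrow> bool" for h where
  monomial: "nonneg_ray h \<alpha> \<beta> \<Longrightarrow> ray_sum h (\<lambda>N. c * exp_mono h (ray \<alpha> \<beta> N))"
| add: "ray_sum h F \<Longrightarrow> ray_sum h G \<Longrightarrow> ray_sum h (\<lambda>N. F N + G N)"
| cong: "ray_sum h F \<Longrightarrow> \<forall>\<^sub>F N in sequentially. F N = G N \<Longrightarrow> ray_sum h G"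

lemma ray_sum_const_mult:
  assumes "ray_sum h F"
  shows "ray_sum h (\<lambda>N. c * F N)"
  using assms
proof induction
  case (monomial \<alpha> \<beta> d)
  then show ?case using ray_sum.monomial[of h \<alpha> \<beta> "c * d"] by (simp add: mult.assoc)
next
  case (add F G)
  then show ?case using ray_sum.add by (simp add: distrib_left)
next
  case (cong F G)
  from cong(2) have "\<forall>\<^sub>F N in sequentially. c * F N = c * G N" by eventually_elim simp
  with cong(3) show ?case by (rule ray_sum.cong)
qed

lemma ray_sum_diff:
  assumes "ray_sum h F" "ray_sum h G"
  shows "ray_sum h (\<lambda>N. F N - G N)"
  using ray_sum.add[OF assms(1) ray_sum_const_mult[OF assms(2), of "-1"]] by simp

lemma ray_sum_mono_mult:
  assumes "ray_sum h F" "nonneg_ray h \<alpha> \<beta>"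
  shows "ray_sum h (\<lambda>N. exp_mono h (ray \<alpha> \<beta> N) * F N)"
  using assms(1)
proof induction
  case (monomial \<alpha>' \<beta>' c)
  let ?\<alpha> = "\<lambda>i. \<alpha> i + \<alpha>' i" and ?\<beta> = "\<lambda>i. \<beta> i + \<beta>' i"
  have ray: "ray ?\<alpha> ?\<beta> N = (\<lambda>i. ray \<alpha> \<beta> N i + ray \<alpha>' \<beta>' N i)" for N
    by (rule ext) (simp add: ray_def algebra_simps)
  from assms(2) monomial have "nonneg_ray h ?\<alpha> ?\<beta>"
    unfolding nonneg_ray_def by eventually_elim (simp add: ray)
  then have "ray_sum h (\<lambda>N. c * exp_mono h (ray ?\<alpha> ?\<beta> N))" by (rule ray_sum.monomial)
  then show ?case
  proof (rule ray_sum.cong)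
    from assms(2) monomial show "\<forall>\<^sub>F N in sequentially. c * exp_mono h (ray ?\<alpha> ?\<beta> N) =
        exp_mono h (ray \<alpha> \<beta> N) * (c * exp_mono h (ray \<alpha>' \<beta>' N))"
      unfolding nonneg_ray_def by eventually_elim (simp only: ray exp_mono_mult ac_simps)
  qed
next
  case (add F G)
  then show ?case using ray_sum.add by (simp add: distrib_left)
next
  case (cong F G)
  from cong(2) have "\<forall>\<^sub>F N in sequentially.
      exp_mono h (ray \<alpha> \<beta> N) * F N = exp_mono h (ray \<alpha> \<beta> N) * G N" by eventually_elim simp
  with cong(3) show ?case by (rule ray_sum.cong)
qed

lemma ray_sum_mult:
  assumes "ray_sum h F" "ray_sum h G"
  shows "ray_sum h (\<lambda>N. F N * G N)"
  using assms(1)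
proof induction
  case (monomial \<alpha> \<beta> c)
  show ?case
    using ray_sum_const_mult[OF ray_sum_mono_mult[OF assms(2) monomial], of c]
    by (simp add: mult.assoc)
next
  case (add F F')
  then show ?case using ray_sum.add by (simp add: distrib_right)
next
  case (cong F F')
  from cong(2) have "\<forall>\<^sub>F N in sequentially. F N * G N = F' N * G N" by eventually_elim simp
  with cong(3) show ?case by (rule ray_sum.cong)
qed

lemma ray_sum_swap_vars:
  assumes "ray_sum h F" "1 \<le> i" "i < h"
  shows "ray_sum h (\<lambda>N. swap_vars i (F N))"
  using assms(1)
proof induction
  case (monomial \<alpha> \<beta> c)
  let ?t = "transpose i (Suc i)"
  have ray: "ray \<alpha> \<beta> N \<circ> ?t = ray (\<alpha> \<circ> ?t) (\<beta> \<circ> ?t) N" for N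
    by (rule ext) (simp add: ray_def)
  have t: "?t k \<in> {1..h}" if "k \<in> {1..h}" for k
    using that assms(2,3) by (auto simp: transpose_def)
  from monomial have "nonneg_ray h (\<alpha> \<circ> ?t) (\<beta> \<circ> ?t)"
    unfolding nonneg_ray_def
  proof eventually_elim
    case (elim N)
    then show ?case unfolding ray[symmetric] using t by (auto simp del: atLeastAtMost_iff)
  qed
  from ray_sum.monomial[OF this, of "swap_vars i c"] show ?case
    using assms(2,3) by (simp add: swap_vars_mult swap_vars_exp_mono ray)
next
  case (add F G)
  then show ?case using ray_sum.add by (simp add: swap_vars_add)
next
  case (cong F G)
  from cong(2) have "\<forall>\<^sub>F N in sequentially. swap_vars i (F N) = swap_vars i (G N)"
    by eventually_elim simp
  with cong(3) show ?case by (rule ray_sum.cong)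
qed

text \<open>\<open>F\<close> is a family of quotients with a denominator independent of N, stated by
  clearing the denominator.\<close>

definition rational_ray :: "nat \<Rightarrow> (nat \<Rightarrow> mpoly) \<Rightarrow> bool" where
  "rational_ray h F \<longleftrightarrow>
     (\<exists>E. (\<forall>(i, j)\<in>#E. i \<noteq> j) \<and> ray_sum h (\<lambda>N. diff_prod E * F N))"

lemma rational_ray_ray_sum: "ray_sum h F \<Longrightarrow> rational_ray h F"
  unfolding rational_ray_def by (intro exI[of _ "{#}"]) simp

lemma rational_ray_mult:
  assumes "rational_ray h F" "rational_ray h G"
  shows "rational_ray h (\<lambda>N. F N * G N)"
proof -
  from assms obtain E E' where E: "\<forall>(i, j)\<in>#E. i \<noteq> j" "ray_sum h (\<lambda>N. diff_prod E * F N)"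
    and E': "\<forall>(i, j)\<in>#E'. i \<noteq> j" "ray_sum h (\<lambda>N. diff_prod E' * G N)"
    unfolding rational_ray_def by blast
  have "ray_sum h (\<lambda>N. diff_prod (E + E') * (F N * G N))"
    using ray_sum_mult[OF E(2) E'(2)] by (simp add: ac_simps)
  then show ?thesis unfolding rational_ray_def using E(1) E'(1) by (intro exI[of _ "E + E'"]) auto
qed

lemma rational_ray_1: "rational_ray h (\<lambda>N. 1)"
proof -
  have "exp_mono h (ray (\<lambda>_. 0) (\<lambda>_. 0) N) = 1" for N by (simp add: exp_mono_eq_prod ray_def)
  moreover have "nonneg_ray h (\<lambda>_. 0) (\<lambda>_. 0)" by (simp add: nonneg_ray_def ray_def)
  ultimately have "ray_sum h (\<lambda>N. 1)"
    using ray_sum.monomial[of h "\<lambda>_. 0" "\<lambda>_. 0" 1] by simp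
  then show ?thesis by (rule rational_ray_ray_sum)
qed

lemma rational_ray_prod:
  assumes "\<And>j. j \<in> J \<Longrightarrow> rational_ray h (F j)"
  shows "rational_ray h (\<lambda>N. \<Prod>j\<in>J. F j N)"
  using assms
  by (induction J rule: infinite_finite_induct) (auto intro: rational_ray_1 rational_ray_mult)

lemma swap_vars_diff_prod:
  assumes "\<forall>(i, j)\<in>#E. i \<noteq> j"
  shows "\<exists>E'. (\<forall>(i, j)\<in>#E'. i \<noteq> j) \<and> swap_vars k (diff_prod E) = diff_prod E'"
  using assms
proof (induction E)
  case empty
  show ?case by (intro exI[of _ "{#}"]) simp
next
  case (add e E)
  obtain i j where e: "e = (i, j)" by (cases e)
  obtain E' where E': "\<forall>(i, j)\<in>#E'. i \<noteq> j" "swap_vars k (diff_prod E) = diff_prod E'"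
    using add by auto
  let ?t = "transpose k (Suc k)"
  have "swap_vars k (diff_prod (add_mset e E)) = diff_prod (add_mset (?t i, ?t j) E')"
    using E'(2) by (simp add: e swap_vars_mult swap_vars_diff swap_vars_var)
  moreover have "?t i \<noteq> ?t j" using add.prems by (auto simp: e dest: transpose_eq_imp_eq)
  ultimately show ?case using E'(1) by (intro exI[of _ "add_mset (?t i, ?t j) E'"]) simp
qed

lemma rational_ray_divided_difference:
  assumes "rational_ray h F" "1 \<le> i" "i < h"
  shows "rational_ray h (\<lambda>N. divided_difference i (F N))"
proof -
  from assms(1) obtain E where E: "\<forall>(i, j)\<in>#E. i \<noteq> j" "ray_sum h (\<lambda>N. diff_prod E * F N)"
    unfolding rational_ray_def by blast
  obtain E' where E': "\<forall>(i, j)\<in>#E'. i \<noteq> j" "swap_vars i (diff_prod E) = diff_prod E'"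
    using swap_vars_diff_prod[OF E(1)] by blast
  \<comment> \<open>If D is a denominator of F, then D times its image under the exchange is a
    common denominator of F and its image; the divided difference adds the factor x_i -
    x_(i+1).\<close>
  let ?E = "add_mset (i, Suc i) (E + E')"
  have "diff_prod ?E * divided_difference i (F N) =
      diff_prod E' * (diff_prod E * F N) - diff_prod E * swap_vars i (diff_prod E * F N)" for N
  proof -
    have "diff_prod ?E * divided_difference i (F N) =
        diff_prod E' * diff_prod E * ((var i - var (Suc i)) * divided_difference i (F N))"
      by (simp add: ac_simps)
    also have "\<dots> = diff_prod E' * diff_prod E * (F N - swap_vars i (F N))"
      by (simp only: divided_difference_mult)
    finally show ?thesis by (simp add: swap_vars_mult E'(2) right_diff_distrib ac_simps)
  qed
  moreover have "ray_sum h (\<lambda>N.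
      diff_prod E' * (diff_prod E * F N) - diff_prod E * swap_vars i (diff_prod E * F N))"
    using ray_sum_const_mult[OF E(2)] ray_sum_const_mult[OF ray_sum_swap_vars[OF E(2) assms(2,3)]]
    by (rule ray_sum_diff)
  ultimately have "ray_sum h (\<lambda>N. diff_prod ?E * divided_difference i (F N))" by simp
  then show ?thesis unfolding rational_ray_def using E(1) E'(1) by (intro exI[of _ ?E]) auto
qed

lemma evpoly_act_ray_sum:
  assumes "ray_sum h F" "ray_poly K"
  shows "evpoly (\<lambda>N. of_int (act (F N) K (\<lambda>i. int N * \<mu> i + \<eta> i)))"
  using assms(1)
proof induction
  case (monomial \<alpha> \<beta> c)
  \<comment> \<open>Multiplication by a monomial on a ray subtracts this ray from the argument in
    the coordinates 1..h. The resulting direction may be negative, which is why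
    \<open>ray_poly\<close> admits integer directions.\<close>
  let ?\<mu> = "\<lambda>i. \<mu> i - (if i \<in> {1..h} then int (\<alpha> i) else 0)"
    and ?\<eta> = "\<lambda>i. \<eta> i - (if i \<in> {1..h} then \<beta> i else 0)"
  from monomial have "\<forall>\<^sub>F N in sequentially.
      of_int (act (c * exp_mono h (ray \<alpha> \<beta> N)) K (\<lambda>i. int N * \<mu> i + \<eta> i)) =
      (of_int (act c K (\<lambda>i. int N * ?\<mu> i + ?\<eta> i)) :: rat)"
    unfolding nonneg_ray_def
  proof eventually_elim
    case (elim N)
    have "(\<lambda>i. int N * \<mu> i + \<eta> i - int (Poly_Mapping.lookup (monomial_exponent h (ray \<alpha> \<beta> N)) i))
        = (\<lambda>i. int N * ?\<mu> i + ?\<eta> i)"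
      by (rule ext) (use elim in \<open>simp add: lookup_monomial_exponent, simp add: ray_def algebra_simps\<close>)
    then show ?case
      by (simp only: mult.commute[of c] act_mult) (simp add: exp_mono_def act_single)
  qed
  moreover have "evpoly (\<lambda>N. of_int (act c K (\<lambda>i. int N * ?\<mu> i + ?\<eta> i)))"
    using ray_poly_act[OF assms(2), of c] unfolding ray_poly_def by (elim allE)
  ultimately show ?case by (rule evpoly_cong[THEN iffD2])
next
  case (add F G)
  then show ?case using evpoly_add by (simp add: act_add)
next
  case (cong F G)
  from cong(2) have "\<forall>\<^sub>F N in sequentially. of_int (act (F N) K (\<lambda>i. int N * \<mu> i + \<eta> i)) =
      (of_int (act (G N) K (\<lambda>i. int N * \<mu> i + \<eta> i)) :: rat)" by eventually_elim simp
  then show ?case using cong(3) by (rule evpoly_cong[THEN iffD1])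
qed

text \<open>If D is the denominator and D acts on \<open>K\<close> to give \<open>delta\<close>,
  then D * F acts on \<open>K\<close> to give the coefficient function of F.\<close>

lemma evpoly_coefficient:
  assumes "rational_ray h F"
  shows "evpoly (\<lambda>N. of_int (coefficient h (ray \<nu> \<eta> N) (F N)))"
proof (cases "\<forall>i\<in>{1..h}. \<forall>\<^sub>F N in sequentially. 0 \<le> ray \<nu> \<eta> N i")
  case True
  \<comment> \<open>\<open>coefficient\<close> looks only at the coordinates 1..h, whereas
    \<open>act\<close> sees all of them, so the target ray is cut off.\<close>
  let ?\<mu> = "\<lambda>i. if i \<in> {1..h} then int (\<nu> i) else 0" and ?\<eta> = "\<lambda>i. if i \<in> {1..h} then \<eta> i else 0"
  from assms obtain E where E: "\<forall>(i, j)\<in>#E. i \<noteq> j" "ray_sum h (\<lambda>N. diff_prod E * F N)"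
    unfolding rational_ray_def by blast
  have "i \<noteq> j" if "(i, j) \<in># E" for i j using E(1) that by auto
  from fundamental_solution[OF this] obtain K where K: "act (diff_prod E) K = delta" "ray_poly K" .
  from True have "\<forall>\<^sub>F N in sequentially. \<forall>i\<in>{1..h}. 0 \<le> ray \<nu> \<eta> N i"
    by (intro eventually_ball_finite) auto
  then have "\<forall>\<^sub>F N in sequentially. of_int (act (diff_prod E * F N) K (\<lambda>i. int N * ?\<mu> i + ?\<eta> i)) =
      (of_int (coefficient h (ray \<nu> \<eta> N) (F N)) :: rat)"
  proof eventually_elim
    case (elim N)
    have "(\<lambda>i. int N * ?\<mu> i + ?\<eta> i) =
        (\<lambda>i. int (Poly_Mapping.lookup (monomial_exponent h (ray \<nu> \<eta> N)) i))"
      by (rule ext) (use elim in \<open>simp add: lookup_monomial_exponent, simp add: ray_def\<close>)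
    moreover have "act (diff_prod E * F N) K = act (F N) delta"
      by (simp only: mult.commute[of "diff_prod E"] act_mult K(1))
    ultimately show ?case using elim by (simp only: act_delta coefficient_def) simp
  qed
  then show ?thesis using evpoly_act_ray_sum[OF E(2) K(2)] by (rule evpoly_cong[THEN iffD1])
next
  case False
  \<comment> \<open>An exponent that is not eventually nonnegative is eventually negative, and there
    \<open>coefficient\<close> is 0 by definition.\<close>
  then obtain i where i: "i \<in> {1..h}" "\<not> (\<forall>\<^sub>F N in sequentially. 0 \<le> ray \<nu> \<eta> N i)" by blast
  then have "\<forall>\<^sub>F N in sequentially. ray \<nu> \<eta> N i < 0"
    using affine_sign_eventually[of "int (\<nu> i)" "\<eta> i"] by (auto simp: ray_def)
  then have "\<forall>\<^sub>F N in sequentially. (of_int (coefficient h (ray \<nu> \<eta> N) (F N)) :: rat) = 0"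
  proof eventually_elim
    case (elim N)
    then have "\<not> (\<forall>i\<in>{1..h}. 0 \<le> ray \<nu> \<eta> N i)" using i(1) by force
    then show ?case by (simp only: coefficient_def if_False of_int_0)
  qed
  then show ?thesis by (rule evpoly_eventually_const)
qed

section \<open>Schubert polynomials\<close>

lemma transpose_Suc_permutes:
  "1 \<le> i \<Longrightarrow> i < m \<Longrightarrow> transpose i (Suc i) permutes {1..m}"
  by (rule permutes_swap_id) auto

lemma comp_transpose_permutes:
  "w permutes {1..m} \<Longrightarrow> 1 \<le> i \<Longrightarrow> i < m \<Longrightarrow> w \<circ> transpose i (Suc i) permutes {1..m}"
  by (rule permutes_compose[OF transpose_Suc_permutes])

lemma comp_transpose_transpose [simp]:
  "w \<circ> transpose a b \<circ> transpose a b = w" for w :: "nat \<Rightarrow> nat"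
  by (rule ext) simp

lemma longest_perm_permutes: "longest_perm m permutes {1..m}"
proof (rule bij_imp_permutes)
  show "bij_betw (longest_perm m) {1..m} {1..m}"
    by (rule bij_betw_byWitness[where f' = "longest_perm m"]) (auto simp: longest_perm_def)
qed (auto simp: longest_perm_def)

lemma is_schubert_permutes: "is_schubert m w f \<Longrightarrow> w permutes {1..m}"
  by (induction rule: is_schubert.induct) (blast intro: longest_perm_permutes comp_transpose_permutes)+

section \<open>Permutations and their Lehmer codes\<close>

lemma lehmer_code_image:
  assumes "w permutes {1..m}"
  shows "lehmer_code m w i = card {a \<in> w ` {i..m}. a < w i}"
proof -
  have "{a \<in> w ` {i..m}. a < w i} = w ` {j \<in> {i<..m}. w j < w i}"
    by (force simp: less_le)
  then show ?thesis
    using permutes_inj_on[OF assms] by (simp add: lehmer_code_def card_image)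
qed

text \<open>Decoding from the left: the values on i..m are those left over by earlier positions, and
  w(i) is the leftover value with exactly code(i) smaller ones.\<close>

lemma lehmer_code_inj:
  assumes w: "w permutes {1..m}" and v: "v permutes {1..m}"
    and code: "\<And>i. i \<in> {1..m} \<Longrightarrow> lehmer_code m w i = lehmer_code m v i"
  shows "w = v"
proof
  fix i
  show "w i = v i"
  proof (induction i rule: less_induct)
    case (less i)
    show ?case
    proof (cases "i \<in> {1..m}")
      case True
      have tail: "u ` {i..m} = {1..m} - u ` {1..<i}" if "u permutes {1..m}" for u
      proof -
        have "{i..m} = {1..m} - {1..<i}" using True by auto
        then show ?thesis
          using permutes_inj[OF that] permutes_image[OF that] by (simp add: image_set_diff)
      qed
      have "w ` {1..<i} = v ` {1..<i}" using less by (intro image_cong) auto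
      then have A: "w ` {i..m} = v ` {i..m}" using tail w v by simp
      let ?A = "v ` {i..m}"
      have "i \<in> {i..m}" using True by simp
      then have mem: "w i \<in> ?A" "v i \<in> ?A" using A by blast+
      have card: "card {a \<in> ?A. a < w i} = card {a \<in> ?A. a < v i}"
        using code[OF True] lehmer_code_image[OF w, of i] lehmer_code_image[OF v, of i] A by simp
      have strict: "card {a \<in> ?A. a < x} < card {a \<in> ?A. a < y}" if "x < y" "x \<in> ?A" for x y
      proof (rule psubset_card_mono)
        have "x \<in> {a \<in> ?A. a < y} - {a \<in> ?A. a < x}" using that by simp
        moreover have "{a \<in> ?A. a < x} \<subseteq> {a \<in> ?A. a < y}" using that by auto
        ultimately show "{a \<in> ?A. a < x} \<subset> {a \<in> ?A. a < y}" by blast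
      qed simp
      show ?thesis
      proof (cases "w i" "v i" rule: linorder_cases)
        case less
        then show ?thesis using strict[OF less mem(1)] card by simp
      next
        case greater
        then show ?thesis using strict[OF greater mem(2)] card by simp
      qed
    next
      case False
      then show ?thesis using w v by (simp add: permutes_not_in)
    qed
  qed
qed

lemma lehmer_code_longest: "i \<in> {1..m} \<Longrightarrow> lehmer_code m (longest_perm m) i = m - i"
proof -
  assume "i \<in> {1..m}"
  then have "{j \<in> {i<..m}. longest_perm m j < longest_perm m i} = {i<..m}"
    by (auto simp: longest_perm_def)
  then show ?thesis by (simp add: lehmer_code_def)
qed

text \<open>If w(i) <= w(i+1), every position counted at i lies beyond i + 1 and is counted at i + 1
  as well, so the code cannot drop.\<close>

lemma lehmer_code_descent:
  assumes "lehmer_code m w (Suc i) < lehmer_code m w i"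
  shows "w (Suc i) < w i"
proof (rule ccontr)
  assume "\<not> w (Suc i) < w i"
  then have "{j \<in> {i<..m}. w j < w i} \<subseteq> {j \<in> {Suc i<..m}. w j < w (Suc i)}"
    using Suc_lessI by fastforce
  then have "lehmer_code m w i \<le> lehmer_code m w (Suc i)"
    unfolding lehmer_code_def by (intro card_mono) simp_all
  then show False using assms by simp
qed

text \<open>The pair (c_i, c_(i+1)) becomes (c_(i+1), c_i - 1), because the larger value loses the
  inversion with its neighbour. Any other position sees the same values to its right, merely
  reordered.\<close>

lemma lehmer_code_swap:
  assumes "1 \<le> i" "i < m" "w (Suc i) < w i"
  shows "lehmer_code m (w \<circ> transpose i (Suc i)) i = lehmer_code m w (Suc i)" (is ?A)
    and "lehmer_code m w i = Suc (lehmer_code m (w \<circ> transpose i (Suc i)) (Suc i))" (is ?B)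
    and "k \<noteq> i \<Longrightarrow> k \<noteq> Suc i \<Longrightarrow>
      lehmer_code m (w \<circ> transpose i (Suc i)) k = lehmer_code m w k"
proof -
  let ?t = "transpose i (Suc i)"
  have t: "?t j = j" if "Suc i < j" for j using that by (simp add: transpose_def)
  have "(j \<in> {i<..m} \<and> w (?t j) < w (Suc i)) \<longleftrightarrow> (j \<in> {Suc i<..m} \<and> w j < w (Suc i))" for j
    using assms t[of j] by (cases "j = Suc i") auto
  then show ?A by (simp add: lehmer_code_def)
  have "j \<in> {i<..m} \<and> w j < w i \<longleftrightarrow>
      j = Suc i \<or> j \<in> {Suc i<..m} \<and> w (?t j) < w i" for j
    using assms t[of j] by (cases "j = Suc i") auto
  then have "{j \<in> {i<..m}. w j < w i} = insert (Suc i) {j \<in> {Suc i<..m}. w (?t j) < w i}"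
    by blast
  then show ?B by (simp add: lehmer_code_def)
  assume k: "k \<noteq> i" "k \<noteq> Suc i"
  have bij: "j \<in> {k<..m} \<Longrightarrow> ?t j \<in> {k<..m}" for j
    using k assms by (auto simp: transpose_def)
  have "{j \<in> {k<..m}. w (?t j) < w k} = ?t ` {j \<in> {k<..m}. w j < w k}"
  proof (intro equalityI subsetI)
    fix j assume "j \<in> {j \<in> {k<..m}. w (?t j) < w k}"
    then show "j \<in> ?t ` {j \<in> {k<..m}. w j < w k}"
      using bij[of j] by (intro image_eqI[of _ _ "?t j"]) auto
  next
    fix j assume "j \<in> ?t ` {j \<in> {k<..m}. w j < w k}"
    then obtain l where "j = ?t l" "l \<in> {k<..m}" "w l < w k" by blast
    then show "j \<in> {j \<in> {k<..m}. w (?t j) < w k}" using bij[of l] by simp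
  qed
  then show "lehmer_code m (w \<circ> ?t) k = lehmer_code m w k"
    using k by (simp add: lehmer_code_def card_image)
qed

text \<open>Counted from the right end, where the bound is 0. With the general upper bound m - i it
  forces the code of the longest element.\<close>

lemma strictly_decreasing_code:
  assumes "\<And>i. 1 \<le> i \<Longrightarrow> i < m \<Longrightarrow> c (Suc i) < (c i :: nat)" "i \<in> {1..m}"
  shows "m - i \<le> c i"
  using assms(2)
proof (induction "m - i" arbitrary: i)
  case (Suc d)
  then have "m - Suc i \<le> c (Suc i)" by (intro Suc(1)) auto
  moreover have "c (Suc i) < c i" using Suc by (intro assms(1)) auto
  ultimately show ?case by linarith
qed simp

lemma lehmer_code_le: "lehmer_code m w i \<le> m - i"
  unfolding lehmer_code_def by (rule order_trans[OF card_mono[of "{i<..m}"]]) auto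

lemma strictly_decreasing_longest:
  assumes w: "w permutes {1..m}" and dec: "\<And>i. 1 \<le> i \<Longrightarrow> i < m \<Longrightarrow> w (Suc i) < w i"
  shows "w = longest_perm m"
proof (rule lehmer_code_inj[OF w longest_perm_permutes])
  fix i assume i: "i \<in> {1..m}"
  have "lehmer_code m w (Suc i) < lehmer_code m w i" if "1 \<le> i" "i < m" for i
  proof -
    have "{j \<in> {i<..m}. w j < w i} \<supseteq> insert (Suc i) {j \<in> {Suc i<..m}. w j < w (Suc i)}"
      using dec[OF that] that by auto
    then have "card (insert (Suc i) {j \<in> {Suc i<..m}. w j < w (Suc i)}) \<le> lehmer_code m w i"
      unfolding lehmer_code_def by (intro card_mono) auto
    then show ?thesis by (simp add: lehmer_code_def)
  qed
  from strictly_decreasing_code[of m "lehmer_code m w", OF this i] lehmer_code_le[of m w i]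
  show "lehmer_code m w i = lehmer_code m (longest_perm m) i"
    by (simp add: lehmer_code_longest[OF i])
qed

section \<open>Existence and uniqueness of Schubert polynomials\<close>

definition weight :: "nat \<Rightarrow> (nat \<Rightarrow> nat) \<Rightarrow> nat" where
  "weight m w = (\<Sum>k\<in>{1..m}. k * w k)"

lemma split_interval:
  "1 \<le> i \<Longrightarrow> i < m \<Longrightarrow> {1..m} = insert i (insert (Suc i) ({1..m} - {i, Suc i}))"
  by auto

text \<open>The weight drops by w(i+1) - w(i). It thus measures the distance to the longest element
  in inductions that exchange ascents.\<close>

lemma weight_less:
  assumes "1 \<le> i" "i < m" "w i < w (Suc i)"
  shows "weight m (w \<circ> transpose i (Suc i)) < weight m w"
proof -
  let ?v = "w \<circ> transpose i (Suc i)" and ?R = "{1..m} - {i, Suc i}"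
  have split: "weight m u = i * u i + (Suc i * u (Suc i) + (\<Sum>k\<in>?R. k * u k))" for u
    unfolding weight_def by (subst split_interval[OF assms(1,2)]) simp
  have "(\<Sum>k\<in>?R. k * ?v k) = (\<Sum>k\<in>?R. k * w k)"
    by (rule sum.cong) (auto simp: transpose_def)
  moreover have "i * w (Suc i) + Suc i * w i < i * w i + Suc i * w (Suc i)"
    using assms(3) by simp
  ultimately show ?thesis by (simp add: split)
qed

lemma is_schubert_ascent:
  assumes "is_schubert m (w \<circ> transpose i (Suc i)) f" "1 \<le> i" "i < m" "w i < w (Suc i)"
  shows "is_schubert m w (divided_difference i f)"
  using is_schubert.descent[OF assms(1-3)] assms(4) by simp

lemma is_schubert_exists: "w permutes {1..m} \<Longrightarrow> \<exists>f. is_schubert m w f"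
proof (induction "weight m w" arbitrary: w rule: less_induct)
  case less
  show ?case
  proof (cases "\<exists>i. 1 \<le> i \<and> i < m \<and> w i < w (Suc i)")
    case True
    then obtain i where i: "1 \<le> i" "i < m" "w i < w (Suc i)" by blast
    then obtain f where "is_schubert m (w \<circ> transpose i (Suc i)) f"
      using less weight_less comp_transpose_permutes by metis
    then show ?thesis using is_schubert_ascent i by blast
  next
    case False
    have "w (Suc i) < w i" if "1 \<le> i" "i < m" for i
    proof -
      have "w i \<noteq> w (Suc i)" using permutes_inj[OF less(2)] by (simp add: inj_eq)
      then show ?thesis using False that by (meson linorder_neqE_nat)
    qed
    then have "w = longest_perm m" using strictly_decreasing_longest less(2) by blast
    then show ?thesis using is_schubert.longest by blast
  qed
qed

text \<open>
  Two ascents $i$, $j$ of $w$ lead to a common longer permutation, along which the divided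
  differences agree by the commutation or the braid relation.
\<close>

lemma ascent_diamond:
  assumes w: "w permutes {1..m}"
    and unique: "\<And>v f g. weight m v < weight m w \<Longrightarrow> is_schubert m v f \<Longrightarrow> is_schubert m v g \<Longrightarrow> f = g"
    and i: "1 \<le> i" "i < m" "w i < w (Suc i)" "is_schubert m (w \<circ> transpose i (Suc i)) f"
    and j: "1 \<le> j" "j < m" "w j < w (Suc j)" "is_schubert m (w \<circ> transpose j (Suc j)) g"
    and "i \<le> j"
  shows "divided_difference i f = divided_difference j g"
proof -
  let ?s = "transpose i (Suc i)" and ?t = "transpose j (Suc j)"
  have less: "weight m (w \<circ> ?s) < weight m w" "weight m (w \<circ> ?t) < weight m w"
    using weight_less i j by auto
  consider "i = j" | "Suc i < j" | "j = Suc i" using \<open>i \<le> j\<close> by linarith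
  then show ?thesis
  proof cases
    case 1
    then show ?thesis using unique[OF less(1)] i j by metis
  next
    case 2
    have "w \<circ> ?s \<circ> ?t permutes {1..m}" using w i j by (intro comp_transpose_permutes)
    then obtain k where k: "is_schubert m (w \<circ> ?s \<circ> ?t) k" using is_schubert_exists by blast
    have "w \<circ> ?s \<circ> ?t = w \<circ> ?t \<circ> ?s"
      by (rule ext) (use 2 in \<open>auto simp: transpose_def\<close>)
    with k have k': "is_schubert m (w \<circ> ?t \<circ> ?s) k" by simp
    have "is_schubert m (w \<circ> ?s) (divided_difference j k)"
      by (rule is_schubert_ascent[OF k]) (use 2 j in \<open>auto simp: transpose_def\<close>)
    then have f: "f = divided_difference j k" using unique less(1) i(4) by blast
    have "is_schubert m (w \<circ> ?t) (divided_difference i k)"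
      by (rule is_schubert_ascent[OF k']) (use 2 i in \<open>auto simp: transpose_def\<close>)
    then have g: "g = divided_difference i k" using unique less(2) j(4) by blast
    show ?thesis unfolding f g by (rule divided_difference_commute[OF 2])
  next
    case 3
    have "w \<circ> ?s \<circ> ?t \<circ> ?s permutes {1..m}" using w i j by (intro comp_transpose_permutes)
    then obtain k where k: "is_schubert m (w \<circ> ?s \<circ> ?t \<circ> ?s) k" using is_schubert_exists by blast
    have "w \<circ> ?s \<circ> ?t \<circ> ?s = w \<circ> ?t \<circ> ?s \<circ> ?t"
      by (rule ext) (use 3 in \<open>auto simp: transpose_def\<close>)
    with k have k': "is_schubert m (w \<circ> ?t \<circ> ?s \<circ> ?t) k" by simp
    have "is_schubert m (w \<circ> ?s \<circ> ?t) (divided_difference i k)"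
      by (rule is_schubert_ascent[OF k]) (use 3 i j in \<open>auto simp: transpose_def\<close>)
    then have "is_schubert m (w \<circ> ?s) (divided_difference j (divided_difference i k))"
      by (rule is_schubert_ascent) (use 3 i j in \<open>auto simp: transpose_def\<close>)
    then have f: "f = divided_difference j (divided_difference i k)"
      using unique less(1) i(4) by blast
    have "is_schubert m (w \<circ> ?t \<circ> ?s) (divided_difference j k)"
      by (rule is_schubert_ascent[OF k']) (use 3 i j in \<open>auto simp: transpose_def\<close>)
    then have "is_schubert m (w \<circ> ?t) (divided_difference i (divided_difference j k))"
      by (rule is_schubert_ascent) (use 3 i j in \<open>auto simp: transpose_def\<close>)
    then have g: "g = divided_difference i (divided_difference j k)"
      using unique less(2) j(4) by blast
    show ?thesis unfolding f g 3 by (rule divided_difference_braid)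
  qed
qed

lemma is_schubert_cases:
  assumes "is_schubert m w f"
  obtains (longest) "w = longest_perm m" "f = (\<Prod>i\<in>{1..<m}. var i ^ (m - i))"
  | (ascent) i g where "1 \<le> i" "i < m" "w i < w (Suc i)"
      "is_schubert m (w \<circ> transpose i (Suc i)) g" "f = divided_difference i g"
  using assms
proof cases
  case longest
  then show ?thesis using that by blast
next
  case (descent v g i)
  have "is_schubert m (w \<circ> transpose i (Suc i)) g" using descent by simp
  moreover have "w i < w (Suc i)" using descent by simp
  ultimately show ?thesis using that(2) descent by blast
qed

text \<open>The longest element has no ascent, so only the first rule reaches it. Any other
  derivation ends at an ascent, and two ascents are reconciled by \<open>ascent_diamond\<close>,
  with uniqueness at smaller weight as induction hypothesis.\<close>

lemma is_schubert_unique: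
  "is_schubert m w f \<Longrightarrow> is_schubert m w g \<Longrightarrow> f = g"
proof (induction "weight m w" arbitrary: w f g rule: less_induct)
  case less
  have w: "w permutes {1..m}" using is_schubert_permutes less(2) by blast
  have unique: "f = g" if "weight m v < weight m w" "is_schubert m v f" "is_schubert m v g" for v f g
    using less(1) that by blast
  have longest: "\<not> w i < w (Suc i)" if "w = longest_perm m" "1 \<le> i" "i < m" for i
    using that by (auto simp: longest_perm_def)
  from less(2) show ?case
  proof (cases rule: is_schubert_cases)
    case f: longest
    from less(3) show ?thesis
      by (cases rule: is_schubert_cases) (use f longest in auto)
  next
    case i: (ascent i f')
    from less(3) show ?thesis
    proof (cases rule: is_schubert_cases)
      case g: longest
      then show ?thesis using i longest by auto
    next
      case j: (ascent j g')
      show ?thesis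
      proof (cases "i \<le> j")
        case True
        show ?thesis unfolding i(5) j(5)
          by (rule ascent_diamond[OF w unique i(1-4) j(1-4) True])
      next
        case False
        then have "j \<le> i" by simp
        show ?thesis unfolding i(5) j(5)
          by (rule ascent_diamond[OF w unique j(1-4) i(1-4) \<open>j \<le> i\<close>, symmetric])
      qed
    qed
  qed
qed

lemma schubert_eq: "is_schubert m w f \<Longrightarrow> schubert m w = f"
  unfolding schubert_def using is_schubert_unique by blast

lemma is_schubert_schubert: "w permutes {1..m} \<Longrightarrow> is_schubert m w (schubert m w)"
  using is_schubert_exists schubert_eq by metis

lemma sum_lehmer_code_swap:
  assumes "1 \<le> i" "i < m" "w (Suc i) < w i"
  shows "(\<Sum>k\<in>{1..m}. lehmer_code m w k) =
    Suc (\<Sum>k\<in>{1..m}. lehmer_code m (w \<circ> transpose i (Suc i)) k)"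
proof -
  let ?R = "{1..m} - {i, Suc i}"
  have split: "(\<Sum>k\<in>{1..m}. lehmer_code m u k) =
      lehmer_code m u i + (lehmer_code m u (Suc i) + (\<Sum>k\<in>?R. lehmer_code m u k))" for u
    by (subst split_interval[OF assms(1,2)]) simp
  have "(\<Sum>k\<in>?R. lehmer_code m (w \<circ> transpose i (Suc i)) k) = (\<Sum>k\<in>?R. lehmer_code m w k)"
    by (rule sum.cong) (use lehmer_code_swap(3)[OF assms] in auto)
  then show ?thesis
    unfolding split by (simp add: lehmer_code_swap(1,2)[OF assms])
qed

text \<open>The degree is the number of inversions. An exchange at a descent lowers the sum of the
  code by 1, and the divided difference lowers the degree by 1.\<close>

lemma homog_is_schubert:
  "is_schubert m w f \<Longrightarrow> homog (\<Sum>k\<in>{1..m}. lehmer_code m w k) f"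
proof (induction rule: is_schubert.induct)
  case longest
  have "homog (\<Sum>i\<in>{1..<m}. m - i) (\<Prod>i\<in>{1..<m}. var i ^ (m - i))"
    by (intro homog_prod homog_var_power)
  moreover have "(\<Sum>k\<in>{1..m}. lehmer_code m (longest_perm m) k) = (\<Sum>i\<in>{1..<m}. m - i)"
  proof -
    have "(\<Sum>k\<in>{1..m}. lehmer_code m (longest_perm m) k) = (\<Sum>k\<in>{1..m}. m - k)"
      by (rule sum.cong) (simp_all add: lehmer_code_longest)
    also have "\<dots> = (\<Sum>k\<in>{1..<m}. m - k)" by (rule sum.mono_neutral_right) auto
    finally show ?thesis .
  qed
  ultimately show ?case by simp
next
  case (descent w f i)
  then show ?case using sum_lehmer_code_swap[of i m w] by (metis homog_divided_difference)
qed

section \<open>Schubert polynomials of codes\<close>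

definition code_ok :: "nat \<Rightarrow> (nat \<Rightarrow> nat) \<Rightarrow> bool" where
  "code_ok m c \<longleftrightarrow> (\<forall>i\<in>{1..m}. c i \<le> m - i)"

text \<open>The effect on the Lehmer code of passing from $w$ to $w s_i$ at an ascent $i$.\<close>

definition raise :: "nat \<Rightarrow> (nat \<Rightarrow> nat) \<Rightarrow> nat \<Rightarrow> nat" where
  "raise i c = c(i := Suc (c (Suc i)), Suc i := c i)"

lemma code_ok_raise:
  assumes "code_ok m c" "1 \<le> i" "i < m" "c i \<le> c (Suc i)"
  shows "code_ok m (raise i c)"
proof -
  have "c (Suc i) \<le> m - Suc i" using assms unfolding code_ok_def by simp
  then have "Suc (c (Suc i)) \<le> m - i" "c i \<le> m - Suc i" using assms by linarith+
  then show ?thesis using assms by (auto simp: code_ok_def raise_def)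
qed

text \<open>\<open>raise\<close> increases the sum of the code by 1 while \<open>code_ok\<close>
  bounds the entries, so raising a code must stop.\<close>

lemma deficit_raise:
  assumes "code_ok m c" "1 \<le> i" "i < m" "c i \<le> c (Suc i)"
  shows "(\<Sum>k\<in>{1..m}. m - raise i c k) < (\<Sum>k\<in>{1..m}. m - c k)"
proof -
  have split: "(\<Sum>k\<in>{1..m}. m - u k) =
      (m - u i) + ((m - u (Suc i)) + (\<Sum>k\<in>{1..m} - {i, Suc i}. m - u k))" for u
    by (subst split_interval[OF assms(2,3)]) simp
  have "(\<Sum>k\<in>{1..m} - {i, Suc i}. m - raise i c k) = (\<Sum>k\<in>{1..m} - {i, Suc i}. m - c k)"
    by (rule sum.cong) (auto simp: raise_def)
  moreover have "c (Suc i) \<le> m - Suc i" using assms unfolding code_ok_def by simp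
  ultimately show ?thesis unfolding split[of c] split[of "raise i c"]
    using assms by (simp add: raise_def)
qed

lemma code_descent_swap:
  assumes w: "w permutes {1..m}" "\<And>k. k \<in> {1..m} \<Longrightarrow> lehmer_code m w k = raise i c k"
    and i: "1 \<le> i" "i < m" "c i \<le> c (Suc i)"
  shows "w (Suc i) < w i"
    and "k \<in> {1..m} \<Longrightarrow> lehmer_code m (w \<circ> transpose i (Suc i)) k = c k"
proof -
  show desc: "w (Suc i) < w i"
    by (rule lehmer_code_descent[of m]) (use w(2)[of i] w(2)[of "Suc i"] i in \<open>simp add: raise_def\<close>)
  note swap = lehmer_code_swap[OF i(1,2) desc]
  show "lehmer_code m (w \<circ> transpose i (Suc i)) k = c k" if "k \<in> {1..m}"
  proof -
    consider "k = i" | "k = Suc i" | "k \<noteq> i" "k \<noteq> Suc i" by blast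
    then show ?thesis
      using swap w(2)[of i] w(2)[of "Suc i"] w(2)[OF that] i by cases (auto simp: raise_def)
  qed
qed

text \<open>A code with a weak ascent is realized by one exchange from a permutation with the raised
  code. A code without weak ascents is strictly decreasing and belongs to the longest
  element.\<close>

lemma code_exists:
  assumes "code_ok m c"
  shows "\<exists>w. w permutes {1..m} \<and> (\<forall>i\<in>{1..m}. lehmer_code m w i = c i)"
  using assms
proof (induction "\<Sum>k\<in>{1..m}. m - c k" arbitrary: c rule: less_induct)
  case less
  show ?case
  proof (cases "\<exists>i. 1 \<le> i \<and> i < m \<and> c i \<le> c (Suc i)")
    case True
    then obtain i where i: "1 \<le> i" "i < m" "c i \<le> c (Suc i)" by blast
    obtain w where w: "w permutes {1..m}" "\<forall>k\<in>{1..m}. lehmer_code m w k = raise i c k"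
      using less(1)[OF deficit_raise code_ok_raise] less(2) i by blast
    then show ?thesis
      using code_descent_swap(2)[OF w(1) _ i] comp_transpose_permutes[OF w(1) i(1,2)]
      by (intro exI[of _ "w \<circ> transpose i (Suc i)"]) blast
  next
    case False
    then have "m - i \<le> c i" if "i \<in> {1..m}" for i
      using that by (intro strictly_decreasing_code[of m c i]) (auto simp: not_le)
    then have "\<forall>i\<in>{1..m}. lehmer_code m (longest_perm m) i = c i"
      using less(2) by (auto simp: lehmer_code_longest code_ok_def intro: le_antisym)
    then show ?thesis using longest_perm_permutes by blast
  qed
qed

definition perm_of :: "nat \<Rightarrow> (nat \<Rightarrow> nat) \<Rightarrow> nat \<Rightarrow> nat" where
  "perm_of m c = (THE w. w permutes {1..m} \<and> (\<forall>i\<in>{1..m}. lehmer_code m w i = c i))"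

lemma perm_of_eqI:
  assumes "w permutes {1..m}" "\<And>i. i \<in> {1..m} \<Longrightarrow> lehmer_code m w i = c i"
  shows "perm_of m c = w"
  unfolding perm_of_def
proof (rule the_equality)
  fix v assume v: "v permutes {1..m} \<and> (\<forall>i\<in>{1..m}. lehmer_code m v i = c i)"
  show "v = w" by (rule lehmer_code_inj[of _ m]) (use v assms in simp_all)
qed (use assms in simp)

lemma perm_of:
  assumes "code_ok m c"
  shows "perm_of m c permutes {1..m}" "i \<in> {1..m} \<Longrightarrow> lehmer_code m (perm_of m c) i = c i"
proof -
  obtain w where w: "w permutes {1..m}" "\<forall>i\<in>{1..m}. lehmer_code m w i = c i"
    using code_exists[OF assms] by blast
  then have "perm_of m c = w" by (intro perm_of_eqI) auto
  with w show "perm_of m c permutes {1..m}" "i \<in> {1..m} \<Longrightarrow> lehmer_code m (perm_of m c) i = c i"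
    by auto
qed

lemma schubert_raise:
  assumes "code_ok m c" "1 \<le> i" "i < m" "c i \<le> c (Suc i)"
  shows "schubert m (perm_of m c) = divided_difference i (schubert m (perm_of m (raise i c)))"
proof -
  let ?w = "perm_of m (raise i c)"
  note w = perm_of[OF code_ok_raise[OF assms]]
  note swap = code_descent_swap[OF w assms(2-4)]
  have "perm_of m c = ?w \<circ> transpose i (Suc i)"
    using comp_transpose_permutes[OF w(1) assms(2,3)] swap(2) by (intro perm_of_eqI) auto
  moreover have "is_schubert m (?w \<circ> transpose i (Suc i)) (divided_difference i (schubert m ?w))"
    using is_schubert_schubert[OF w(1)] assms(2,3) swap(1) by (intro is_schubert.descent) auto
  ultimately show ?thesis using schubert_eq by simp
qed

text \<open>At an equality c_i = c_(i+1), raising multiplies the monomial by x_i. The original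
  monomial is symmetric in x_i and x_(i+1), so the divided difference removes just this factor.
  Without equalities the permutation is the longest element.\<close>

lemma schubert_dominant:
  assumes "code_ok m c" "\<And>i. 1 \<le> i \<Longrightarrow> i < m \<Longrightarrow> c (Suc i) \<le> c i"
  shows "schubert m (perm_of m c) = (\<Prod>i\<in>{1..m}. var i ^ c i)"
  using assms
proof (induction "\<Sum>k\<in>{1..m}. m - c k" arbitrary: c rule: less_induct)
  case less
  note ok = less(2) and dom = less(3)
  show ?case
  proof (cases "\<exists>i. 1 \<le> i \<and> i < m \<and> c i = c (Suc i)")
    case True
    \<comment> \<open>With the leftmost equality, the entries before i strictly decrease, so the
      code stays weakly decreasing after 1 is added to c_i.\<close>
    define i where "i = (LEAST i. 1 \<le> i \<and> i < m \<and> c i = c (Suc i))"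
    have i: "1 \<le> i" "i < m" "c i = c (Suc i)"
      using LeastI_ex[OF True] unfolding i_def by auto
    have min: "c (Suc k) < c k" if "1 \<le> k" "k < i" for k
      using dom[of k] not_less_Least[of k "\<lambda>i. 1 \<le> i \<and> i < m \<and> c i = c (Suc i)"] that i(2)
      unfolding i_def[symmetric] by (force simp: le_less)
    have raise: "raise i c = c(i := Suc (c i))" using i(3) by (auto simp: raise_def)
    let ?P = "\<lambda>c. \<Prod>i\<in>{1..m}. var i ^ c i"
    have "schubert m (perm_of m (raise i c)) = ?P (raise i c)"
    proof (rule less(1))
      show "(\<Sum>k\<in>{1..m}. m - raise i c k) < (\<Sum>k\<in>{1..m}. m - c k)"
        using deficit_raise[OF ok i(1,2)] i(3) by simp
      show "code_ok m (raise i c)" using code_ok_raise[OF ok i(1,2)] i(3) by simp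
      show "raise i c (Suc k) \<le> raise i c k" if "1 \<le> k" "k < m" for k
        using dom[OF that] min[of k] that unfolding raise by auto
    qed
    also have "?P (raise i c) = var i * ?P c"
    proof -
      have "?P (raise i c) = var i ^ Suc (c i) * (\<Prod>k\<in>{1..m} - {i}. var k ^ raise i c k)"
        using i by (subst prod.remove[of _ i]) (auto simp: raise)
      also have "(\<Prod>k\<in>{1..m} - {i}. var k ^ raise i c k) = (\<Prod>k\<in>{1..m} - {i}. var k ^ c k)"
        by (rule prod.cong) (auto simp: raise)
      also have "var i ^ Suc (c i) * \<dots> = var i * ?P c"
        using i prod.remove[of "{1..m}" i "\<lambda>k. var k ^ c k"] by (simp add: mult.assoc)
      finally show ?thesis .
    qed
    also have "divided_difference i \<dots> = ?P c"
    proof (rule divided_difference_eqI)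
      have P: "?P c = exp_mono m (\<lambda>i. int (c i))" by (simp add: exp_mono_eq_prod)
      have "(\<lambda>i. int (c i)) \<circ> transpose i (Suc i) = (\<lambda>i. int (c i))"
        using i(3) by (auto simp: transpose_def)
      then have "swap_vars i (?P c) = ?P c"
        unfolding P using swap_vars_exp_mono[OF i(1,2)] by simp
      then show "(var i - var (Suc i)) * ?P c = var i * ?P c - swap_vars i (var i * ?P c)"
        by (simp add: swap_vars_mult swap_vars_var left_diff_distrib)
    qed
    finally show ?thesis using schubert_raise[OF ok i(1,2)] i(3) by simp
  next
    case False
    then have "c (Suc i) < c i" if "1 \<le> i" "i < m" for i
      using dom[OF that] that by (metis le_neq_implies_less)
    then have "m - i \<le> c i" if "i \<in> {1..m}" for i
      using that by (intro strictly_decreasing_code[of m c i])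
    then have c: "c i = m - i" if "i \<in> {1..m}" for i
      using that ok by (auto simp: code_ok_def intro: le_antisym)
    have "perm_of m c = longest_perm m"
      using c by (intro perm_of_eqI longest_perm_permutes) (simp add: lehmer_code_longest)
    then have "schubert m (perm_of m c) = (\<Prod>i\<in>{1..<m}. var i ^ (m - i))"
      using schubert_eq[OF is_schubert.longest] by simp
    also have "\<dots> = (\<Prod>i\<in>{1..m}. var i ^ (m - i))"
      by (rule prod.mono_neutral_left) auto
    also have "\<dots> = (\<Prod>i\<in>{1..m}. var i ^ c i)"
      by (rule prod.cong) (simp_all add: c)
    finally show ?thesis .
  qed
qed

section \<open>Integer codes padded by zeroes\<close>

definition valid_code :: "nat \<Rightarrow> nat \<Rightarrow> (nat \<Rightarrow> int) \<Rightarrow> bool" where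
  "valid_code h t \<gamma> \<longleftrightarrow> lehmer_ineqs h t \<gamma> \<and> (\<forall>i\<in>{1..h}. 0 \<le> \<gamma> i)"

definition pad :: "nat \<Rightarrow> (nat \<Rightarrow> int) \<Rightarrow> nat \<Rightarrow> nat" where
  "pad h \<gamma> i = (if i \<le> h then nat (\<gamma> i) else 0)"

lemma code_ok_pad:
  assumes "valid_code h t \<gamma>"
  shows "code_ok (h + t) (pad h \<gamma>)"
  using assms unfolding code_ok_def valid_code_def lehmer_ineqs_def pad_def
  by (fastforce simp: nat_le_iff)

lemma code_perm_eq:
  assumes "valid_code h t \<gamma>"
  shows "code_perm h t \<gamma> = perm_of (h + t) (pad h \<gamma>)"
proof -
  have "(int (lehmer_code (h + t) w i) = (if i \<le> h then \<gamma> i else 0)) \<longleftrightarrow>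
      lehmer_code (h + t) w i = pad h \<gamma> i" if "i \<in> {1..h + t}" for w i
  proof (cases "i \<le> h")
    case True
    then have "0 \<le> \<gamma> i" using assms that by (auto simp: valid_code_def)
    then show ?thesis using True by (auto simp: pad_def)
  qed (simp add: pad_def)
  then show ?thesis unfolding code_perm_def perm_of_def by (metis (lifting))
qed

lemma homog_schubert_code:
  assumes "valid_code h t \<gamma>"
  shows "homog (nat (total_degree h \<gamma>)) (schubert (h + t) (code_perm h t \<gamma>))"
proof -
  let ?w = "perm_of (h + t) (pad h \<gamma>)"
  note w = perm_of[OF code_ok_pad[OF assms]]
  have "(\<Sum>k\<in>{1..h + t}. lehmer_code (h + t) ?w k) = (\<Sum>k\<in>{1..h + t}. pad h \<gamma> k)"
    by (rule sum.cong) (auto simp: w(2))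
  also have "\<dots> = (\<Sum>k\<in>{1..h}. pad h \<gamma> k)"
    by (rule sum.mono_neutral_right) (auto simp: pad_def)
  also have "\<dots> = nat (total_degree h \<gamma>)"
  proof -
    have "int (\<Sum>k\<in>{1..h}. pad h \<gamma> k) = total_degree h \<gamma>"
      unfolding total_degree_def of_nat_sum
      by (rule sum.cong) (use assms in \<open>auto simp: pad_def valid_code_def\<close>)
    then show ?thesis by (metis nat_int)
  qed
  finally show ?thesis
    using homog_is_schubert[OF is_schubert_schubert[OF w(1)]] by (simp add: code_perm_eq[OF assms])
qed

text \<open>The Lehmer bound at i + 1 is smaller by 1 than that at i, which leaves room for the
  added 1: the same \<open>t\<close> works. Since i < h, the trailing zeroes are untouched.\<close>

lemma schubert_code_step:
  assumes valid: "valid_code h t \<gamma>" and i: "1 \<le> i" "i < h" "\<gamma> i \<le> \<gamma> (Suc i)"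
  defines "\<gamma>' \<equiv> \<gamma>(i := \<gamma> (Suc i) + 1, Suc i := \<gamma> i)"
  shows "valid_code h t \<gamma>'"
    and "schubert (h + t) (code_perm h t \<gamma>) =
      divided_difference i (schubert (h + t) (code_perm h t \<gamma>'))"
proof -
  have "Suc i \<in> {1..h}" "i \<in> {1..h}" using i by auto
  then have "\<gamma> (Suc i) \<le> int h + int t - int (Suc i)" and nonneg: "0 \<le> \<gamma> i" "0 \<le> \<gamma> (Suc i)"
    using valid unfolding valid_code_def lehmer_ineqs_def by blast+
  then show valid': "valid_code h t \<gamma>'"
    using valid i by (auto simp: valid_code_def lehmer_ineqs_def \<gamma>'_def)
  have "pad h \<gamma>' = raise i (pad h \<gamma>)"
    using i nonneg by (auto simp: fun_eq_iff pad_def raise_def \<gamma>'_def nat_add_distrib)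
  moreover have "pad h \<gamma> i \<le> pad h \<gamma> (Suc i)" using i by (simp add: pad_def)
  ultimately show "schubert (h + t) (code_perm h t \<gamma>) =
      divided_difference i (schubert (h + t) (code_perm h t \<gamma>'))"
    using schubert_raise[OF code_ok_pad[OF valid] i(1)] i(2)
    by (simp add: code_perm_eq[OF valid] code_perm_eq[OF valid'])
qed

text \<open>Nonnegative entries followed by zeroes stay weakly decreasing, also across position h,
  so the monomial is the same for every \<open>t\<close>.\<close>

lemma schubert_code_dominant:
  assumes valid: "valid_code h t \<gamma>" and dom: "\<And>i. 1 \<le> i \<Longrightarrow> i < h \<Longrightarrow> \<gamma> (Suc i) \<le> \<gamma> i"
  shows "schubert (h + t) (code_perm h t \<gamma>) = exp_mono h \<gamma>"
proof -
  have "schubert (h + t) (code_perm h t \<gamma>) = (\<Prod>i\<in>{1..h + t}. var i ^ pad h \<gamma> i)"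
    unfolding code_perm_eq[OF valid]
  proof (rule schubert_dominant[OF code_ok_pad[OF valid]])
    fix i assume "1 \<le> i" "i < h + t"
    then show "pad h \<gamma> (Suc i) \<le> pad h \<gamma> i" using dom[of i] by (auto simp: pad_def intro: nat_mono)
  qed
  also have "\<dots> = (\<Prod>i\<in>{1..h}. var i ^ pad h \<gamma> i)"
    by (rule prod.mono_neutral_right) (auto simp: pad_def)
  also have "\<dots> = exp_mono h \<gamma>"
    unfolding exp_mono_eq_prod by (rule prod.cong) (auto simp: pad_def)
  finally show ?thesis .
qed

section \<open>Schubert polynomials along rays\<close>

text \<open>\<open>G\<close> is independent of \<open>t\<close>, and one threshold for N serves
  every admissible \<open>t\<close>; this absorbs the appending of fixed points.\<close>

definition schubert_rational :: "nat \<Rightarrow> (nat \<Rightarrow> nat) \<Rightarrow> (nat \<Rightarrow> int) \<Rightarrow> bool" where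
  "schubert_rational h \<alpha> \<beta> \<longleftrightarrow> (\<exists>G. rational_ray h G \<and>
     (\<forall>\<^sub>F N in sequentially. \<forall>t. lehmer_ineqs h t (ray \<alpha> \<beta> N) \<longrightarrow>
        schubert (h + t) (code_perm h t (ray \<alpha> \<beta> N)) = G N))"

lemma schubert_rational_sorted:
  assumes nonneg: "nonneg_ray h \<alpha> \<beta>"
    and sorted: "\<And>i. 1 \<le> i \<Longrightarrow> i < h \<Longrightarrow>
      \<forall>\<^sub>F N in sequentially. ray \<alpha> \<beta> N (Suc i) \<le> ray \<alpha> \<beta> N i"
  shows "schubert_rational h \<alpha> \<beta>"
proof -
  have "rational_ray h (\<lambda>N. 1 * exp_mono h (ray \<alpha> \<beta> N))"
    by (intro rational_ray_ray_sum ray_sum.monomial nonneg)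
  moreover have "\<forall>\<^sub>F N in sequentially. \<forall>i\<in>{1..<h}. ray \<alpha> \<beta> N (Suc i) \<le> ray \<alpha> \<beta> N i"
    using sorted by (intro eventually_ball_finite) auto
  with nonneg have "\<forall>\<^sub>F N in sequentially. \<forall>t. lehmer_ineqs h t (ray \<alpha> \<beta> N) \<longrightarrow>
      schubert (h + t) (code_perm h t (ray \<alpha> \<beta> N)) = 1 * exp_mono h (ray \<alpha> \<beta> N)"
    unfolding nonneg_ray_def
  proof eventually_elim
    case (elim N)
    then show ?case using schubert_code_dominant[of h _ "ray \<alpha> \<beta> N"] by (auto simp: valid_code_def)
  qed
  ultimately show ?thesis unfolding schubert_rational_def by blast
qed

lemma schubert_rational_step:
  assumes nonneg: "nonneg_ray h \<alpha> \<beta>" and i: "1 \<le> i" "i < h"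
    and asc: "\<forall>\<^sub>F N in sequentially. ray \<alpha> \<beta> N i \<le> ray \<alpha> \<beta> N (Suc i)"
  defines "\<alpha>' \<equiv> \<alpha>(i := \<alpha> (Suc i), Suc i := \<alpha> i)"
    and "\<beta>' \<equiv> \<beta>(i := \<beta> (Suc i) + 1, Suc i := \<beta> i)"
  shows "nonneg_ray h \<alpha>' \<beta>'" and "schubert_rational h \<alpha>' \<beta>' \<Longrightarrow> schubert_rational h \<alpha> \<beta>"
proof -
  have ray: "ray \<alpha>' \<beta>' N = (ray \<alpha> \<beta> N)(i := ray \<alpha> \<beta> N (Suc i) + 1, Suc i := ray \<alpha> \<beta> N i)" for N
    by (auto simp: ray_def \<alpha>'_def \<beta>'_def)
  from nonneg show "nonneg_ray h \<alpha>' \<beta>'"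
    unfolding nonneg_ray_def
  proof eventually_elim
    case (elim N)
    have "0 \<le> ray \<alpha> \<beta> N i" "0 \<le> ray \<alpha> \<beta> N (Suc i)" using elim i by auto
    then show ?case using elim unfolding ray by auto
  qed
  assume "schubert_rational h \<alpha>' \<beta>'"
  then obtain G where G: "rational_ray h G" "\<forall>\<^sub>F N in sequentially. \<forall>t.
      lehmer_ineqs h t (ray \<alpha>' \<beta>' N) \<longrightarrow> schubert (h + t) (code_perm h t (ray \<alpha>' \<beta>' N)) = G N"
    unfolding schubert_rational_def by blast
  from G(2) nonneg asc have "\<forall>\<^sub>F N in sequentially. \<forall>t. lehmer_ineqs h t (ray \<alpha> \<beta> N) \<longrightarrow>
      schubert (h + t) (code_perm h t (ray \<alpha> \<beta> N)) = divided_difference i (G N)"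
    unfolding nonneg_ray_def
  proof eventually_elim
    case (elim N)
    show ?case
    proof (intro allI impI)
      fix t assume "lehmer_ineqs h t (ray \<alpha> \<beta> N)"
      then have valid: "valid_code h t (ray \<alpha> \<beta> N)" using elim(2) by (simp add: valid_code_def)
      note step = schubert_code_step[OF valid i elim(3), folded ray]
      show "schubert (h + t) (code_perm h t (ray \<alpha> \<beta> N)) = divided_difference i (G N)"
        using step elim(1) by (simp add: valid_code_def)
    qed
  qed
  with rational_ray_divided_difference[OF G(1) i] show "schubert_rational h \<alpha> \<beta>"
    unfolding schubert_rational_def by blast
qed

text \<open>
  Insertion sort: the first \<open>p\<close> entries are strictly decreasing except that the entry at position
  \<open>r + 1\<close> is still to be moved to the left. A swap adds 1 to the larger of the two entries, which
  moves to the left, and so keeps strict inequalities intact.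
\<close>

lemma schubert_rational_insert:
  assumes "nonneg_ray h \<alpha> \<beta>" "r \<le> p" "p \<le> h" "r = p \<longrightarrow> p = 0"
    and "\<And>k. 1 \<le> k \<Longrightarrow> k < p \<Longrightarrow> k \<noteq> r \<Longrightarrow>
      \<forall>\<^sub>F N in sequentially. ray \<alpha> \<beta> N (Suc k) < ray \<alpha> \<beta> N k"
    and "1 \<le> r \<Longrightarrow> Suc r < p \<Longrightarrow> \<forall>\<^sub>F N in sequentially. ray \<alpha> \<beta> N (Suc (Suc r)) < ray \<alpha> \<beta> N r"
  shows "schubert_rational h \<alpha> \<beta>"
  using assms
proof (induction "h - p" arbitrary: p r \<alpha> \<beta> rule: less_induct)
  case outer: less
  from outer.prems show ?case
  proof (induction r arbitrary: \<alpha> \<beta>)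
    case 0
    note sorted = \<open>\<And>k. 1 \<le> k \<Longrightarrow> k < p \<Longrightarrow> k \<noteq> 0 \<Longrightarrow> _\<close>
    show ?case
    proof (cases "p = h")
      case True
      show ?thesis
      proof (rule schubert_rational_sorted[OF \<open>nonneg_ray h \<alpha> \<beta>\<close>])
        fix i assume "1 \<le> i" "i < h"
        then have "\<forall>\<^sub>F N in sequentially. ray \<alpha> \<beta> N (Suc i) < ray \<alpha> \<beta> N i"
          using sorted True by simp
        then show "\<forall>\<^sub>F N in sequentially. ray \<alpha> \<beta> N (Suc i) \<le> ray \<alpha> \<beta> N i"
          by eventually_elim simp
      qed
    next
      case False
      \<comment> \<open>The first p entries are strictly decreasing. The entry at position p + 1 is
        inserted next, with r = p in a prefix of length p + 1.\<close>
      then show ?thesis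
        by (intro outer.hyps[of "Suc p" \<alpha> \<beta> p])
          (use \<open>nonneg_ray h \<alpha> \<beta>\<close> \<open>p \<le> h\<close> sorted in auto)
    qed
  next
    case (Suc r)
    let ?i = "Suc r"
    have p: "Suc ?i \<le> p" using Suc.prems by simp
    have "(\<forall>\<^sub>F N in sequentially. ray \<alpha> \<beta> N ?i \<le> ray \<alpha> \<beta> N (Suc ?i)) \<or>
        (\<forall>\<^sub>F N in sequentially. ray \<alpha> \<beta> N (Suc ?i) < ray \<alpha> \<beta> N ?i)"
      using affine_sign_eventually[of "int (\<alpha> (Suc ?i)) - int (\<alpha> ?i)" "\<beta> (Suc ?i) - \<beta> ?i"]
      by (simp add: ray_def algebra_simps)
    then show ?case
    proof
      assume asc: "\<forall>\<^sub>F N in sequentially. ray \<alpha> \<beta> N ?i \<le> ray \<alpha> \<beta> N (Suc ?i)"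
      let ?\<alpha> = "\<alpha>(?i := \<alpha> (Suc ?i), Suc ?i := \<alpha> ?i)"
      let ?\<beta> = "\<beta>(?i := \<beta> (Suc ?i) + 1, Suc ?i := \<beta> ?i)"
      have ray: "ray ?\<alpha> ?\<beta> N =
          (ray \<alpha> \<beta> N)(?i := ray \<alpha> \<beta> N (Suc ?i) + 1, Suc ?i := ray \<alpha> \<beta> N ?i)" for N
        by (auto simp: ray_def)
      have "1 \<le> ?i" "?i < h" using p \<open>p \<le> h\<close> by auto
      note step = schubert_rational_step[OF \<open>nonneg_ray h \<alpha> \<beta>\<close> this asc]
      have "schubert_rational h ?\<alpha> ?\<beta>"
      proof (rule Suc.IH[OF step(1)])
        show "r \<le> p" "p \<le> h" "r = p \<longrightarrow> p = 0" using p \<open>p \<le> h\<close> by auto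
      next
        fix k assume k: "1 \<le> k" "k < p" "k \<noteq> r"
        consider "k = ?i" | "k = Suc ?i" | "k \<noteq> ?i" "k \<noteq> Suc ?i" by blast
        then show "\<forall>\<^sub>F N in sequentially. ray ?\<alpha> ?\<beta> N (Suc k) < ray ?\<alpha> ?\<beta> N k"
        proof cases
          case 1
          from asc show ?thesis by eventually_elim (simp add: 1 ray)
        next
          case 2
          \<comment> \<open>The entry displaced to the right meets the former right neighbour of the
            moving entry; their comparison is the last hypothesis.\<close>
          have "\<forall>\<^sub>F N in sequentially. ray \<alpha> \<beta> N (Suc (Suc ?i)) < ray \<alpha> \<beta> N ?i"
            using Suc.prems(6) 2 k by simp
          then show ?thesis by eventually_elim (simp add: 2 ray)
        next
          case 3
          have "\<forall>\<^sub>F N in sequentially. ray \<alpha> \<beta> N (Suc k) < ray \<alpha> \<beta> N k"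
            using Suc.prems(5)[of k] 3 k by simp
          then show ?thesis by eventually_elim (use 3 k in \<open>simp add: ray\<close>)
        qed
      next
        assume r: "1 \<le> r" "Suc r < p"
        then have "\<forall>\<^sub>F N in sequentially. ray \<alpha> \<beta> N (Suc r) < ray \<alpha> \<beta> N r"
          using Suc.prems(5)[of r] by simp
        then show "\<forall>\<^sub>F N in sequentially. ray ?\<alpha> ?\<beta> N (Suc (Suc r)) < ray ?\<alpha> ?\<beta> N r"
          by eventually_elim (simp add: ray)
      qed
      then show ?thesis by (rule step(2))
    next
      \<comment> \<open>The entry has reached its place. The induction still runs down to r = 0,
        testing the comparisons further left again.\<close>
      assume desc: "\<forall>\<^sub>F N in sequentially. ray \<alpha> \<beta> N (Suc ?i) < ray \<alpha> \<beta> N ?i"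
      show ?thesis
      proof (rule Suc.IH[OF \<open>nonneg_ray h \<alpha> \<beta>\<close>])
        show "r \<le> p" "p \<le> h" "r = p \<longrightarrow> p = 0" using p \<open>p \<le> h\<close> by auto
      next
        fix k assume "1 \<le> k" "k < p" "k \<noteq> r"
        then show "\<forall>\<^sub>F N in sequentially. ray \<alpha> \<beta> N (Suc k) < ray \<alpha> \<beta> N k"
          using Suc.prems(5)[of k] desc by (cases "k = ?i") auto
      next
        assume r: "1 \<le> r" "Suc r < p"
        then have "\<forall>\<^sub>F N in sequentially. ray \<alpha> \<beta> N (Suc r) < ray \<alpha> \<beta> N r"
          using Suc.prems(5)[of r] by simp
        with desc show "\<forall>\<^sub>F N in sequentially. ray \<alpha> \<beta> N (Suc (Suc r)) < ray \<alpha> \<beta> N r"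
          by eventually_elim simp
      qed
    qed
  qed
qed

lemma schubert_rational_nonneg_ray: "nonneg_ray h \<alpha> \<beta> \<Longrightarrow> schubert_rational h \<alpha> \<beta>"
  by (rule schubert_rational_insert[of h \<alpha> \<beta> 0 0]) auto

section \<open>Vanishing of coefficients in the wrong degree\<close>

lemma mdeg_monomial_exponent:
  assumes "\<And>i. i \<in> {1..h} \<Longrightarrow> 0 \<le> a i"
  shows "int (mdeg (monomial_exponent h a)) = total_degree h a"
proof -
  have "mdeg (\<Sum>i\<in>S. Poly_Mapping.single i (nat (a i))) = (\<Sum>i\<in>S. nat (a i))" if "finite S" for S
    using that by induction (simp_all add: mdeg_add, simp add: mdeg_def)
  then show ?thesis using assms by (simp add: monomial_exponent_def total_degree_def)
qed

lemma coefficient_homog: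
  assumes "homog d f" "total_degree h a \<noteq> int d"
  shows "coefficient h a f = 0"
proof (cases "\<forall>i\<in>{1..h}. 0 \<le> a i")
  case True
  then have "int (mdeg (monomial_exponent h a)) \<noteq> int d"
    using assms(2) mdeg_monomial_exponent[of h a] by simp
  then have "monomial_exponent h a \<notin> Poly_Mapping.keys f" using assms(1) by (auto simp: homog_def)
  then show ?thesis by (simp add: coefficient_def in_keys_iff)
qed (auto simp: coefficient_def)

theorem proposition6p1:
  fixes h s :: nat
    and \<alpha> :: "nat \<Rightarrow> nat \<Rightarrow> nat" and \<beta> :: "nat \<Rightarrow> nat \<Rightarrow> int"
    and \<nu> :: "nat \<Rightarrow> nat" and \<eta> :: "nat \<Rightarrow> int"
  assumes "\<And>j. j \<in> {1..s} \<Longrightarrow>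
             \<forall>\<^sub>F N in sequentially. \<forall>i\<in>{1..h}. 0 \<le> ray (\<alpha> j) (\<beta> j) N i"
  shows "(\<exists>P :: rat poly. \<forall>\<^sub>F N in sequentially. \<forall>t :: nat \<Rightarrow> nat.
            (\<forall>j\<in>{1..s}. lehmer_ineqs h (t j) (ray (\<alpha> j) (\<beta> j) N)) \<longrightarrow>
            of_int (coefficient h (ray \<nu> \<eta> N)
              (\<Prod>j\<in>{1..s}. schubert (h + t j) (code_perm h (t j) (ray (\<alpha> j) (\<beta> j) N))))
            = poly P (of_nat N))
       \<and> ((\<forall>\<^sub>F N in sequentially.
            total_degree h (ray \<nu> \<eta> N) \<noteq> (\<Sum>j\<in>{1..s}. total_degree h (ray (\<alpha> j) (\<beta> j) N))) \<longrightarrow>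
          (\<forall>\<^sub>F N in sequentially. \<forall>t :: nat \<Rightarrow> nat.
            (\<forall>j\<in>{1..s}. lehmer_ineqs h (t j) (ray (\<alpha> j) (\<beta> j) N)) \<longrightarrow>
            coefficient h (ray \<nu> \<eta> N)
              (\<Prod>j\<in>{1..s}. schubert (h + t j) (code_perm h (t j) (ray (\<alpha> j) (\<beta> j) N))) = 0))"
proof (intro conjI impI)
  have "\<forall>j\<in>{1..s}. \<exists>G. rational_ray h G \<and>
      (\<forall>\<^sub>F N in sequentially. \<forall>t. lehmer_ineqs h t (ray (\<alpha> j) (\<beta> j) N) \<longrightarrow>
        schubert (h + t) (code_perm h t (ray (\<alpha> j) (\<beta> j) N)) = G N)"
  proof
    fix j assume "j \<in> {1..s}"
    then have "nonneg_ray h (\<alpha> j) (\<beta> j)" unfolding nonneg_ray_def by (rule assms)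
    then show "\<exists>G. rational_ray h G \<and>
        (\<forall>\<^sub>F N in sequentially. \<forall>t. lehmer_ineqs h t (ray (\<alpha> j) (\<beta> j) N) \<longrightarrow>
          schubert (h + t) (code_perm h t (ray (\<alpha> j) (\<beta> j) N)) = G N)"
      by (rule schubert_rational_nonneg_ray[unfolded schubert_rational_def])
  qed
  from bchoice[OF this] obtain G where G: "\<forall>j\<in>{1..s}. rational_ray h (G j) \<and>
      (\<forall>\<^sub>F N in sequentially. \<forall>t. lehmer_ineqs h t (ray (\<alpha> j) (\<beta> j) N) \<longrightarrow>
        schubert (h + t) (code_perm h t (ray (\<alpha> j) (\<beta> j) N)) = G j N)" ..
  then have "rational_ray h (\<lambda>N. \<Prod>j\<in>{1..s}. G j N)" by (intro rational_ray_prod) blast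
  from evpoly_coefficient[OF this] obtain P :: "rat poly" where P: "\<forall>\<^sub>F N in sequentially.
      of_int (coefficient h (ray \<nu> \<eta> N) (\<Prod>j\<in>{1..s}. G j N)) = poly P (of_nat N)"
    unfolding evpoly_def by blast
  \<comment> \<open>Finitely many j share one threshold for N, valid for all paddings at once, so
    each factor may use its own \<open>t j\<close>.\<close>
  from G have "\<forall>\<^sub>F N in sequentially. \<forall>j\<in>{1..s}. \<forall>t. lehmer_ineqs h t (ray (\<alpha> j) (\<beta> j) N) \<longrightarrow>
        schubert (h + t) (code_perm h t (ray (\<alpha> j) (\<beta> j) N)) = G j N"
    by (intro eventually_ball_finite) auto
  with P have "\<forall>\<^sub>F N in sequentially. \<forall>t :: nat \<Rightarrow> nat.
      (\<forall>j\<in>{1..s}. lehmer_ineqs h (t j) (ray (\<alpha> j) (\<beta> j) N)) \<longrightarrow>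
      of_int (coefficient h (ray \<nu> \<eta> N)
        (\<Prod>j\<in>{1..s}. schubert (h + t j) (code_perm h (t j) (ray (\<alpha> j) (\<beta> j) N))))
      = poly P (of_nat N)"
  proof eventually_elim
    case (elim N)
    show ?case
    proof (intro allI impI)
      fix t :: "nat \<Rightarrow> nat"
      assume "\<forall>j\<in>{1..s}. lehmer_ineqs h (t j) (ray (\<alpha> j) (\<beta> j) N)"
      then have "(\<Prod>j\<in>{1..s}. schubert (h + t j) (code_perm h (t j) (ray (\<alpha> j) (\<beta> j) N))) =
          (\<Prod>j\<in>{1..s}. G j N)"
        using elim(2) by (intro prod.cong) blast+
      then show "of_int (coefficient h (ray \<nu> \<eta> N)
          (\<Prod>j\<in>{1..s}. schubert (h + t j) (code_perm h (t j) (ray (\<alpha> j) (\<beta> j) N))))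
          = poly P (of_nat N)" using elim(1) by simp
    qed
  qed
  then show "\<exists>P :: rat poly. \<forall>\<^sub>F N in sequentially. \<forall>t :: nat \<Rightarrow> nat.
      (\<forall>j\<in>{1..s}. lehmer_ineqs h (t j) (ray (\<alpha> j) (\<beta> j) N)) \<longrightarrow>
      of_int (coefficient h (ray \<nu> \<eta> N)
        (\<Prod>j\<in>{1..s}. schubert (h + t j) (code_perm h (t j) (ray (\<alpha> j) (\<beta> j) N))))
      = poly P (of_nat N)" ..
next
  assume "\<forall>\<^sub>F N in sequentially.
    total_degree h (ray \<nu> \<eta> N) \<noteq> (\<Sum>j\<in>{1..s}. total_degree h (ray (\<alpha> j) (\<beta> j) N))"
  moreover have "\<forall>\<^sub>F N in sequentially. \<forall>j\<in>{1..s}. \<forall>i\<in>{1..h}. 0 \<le> ray (\<alpha> j) (\<beta> j) N i"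
    using assms by (intro eventually_ball_finite) auto
  ultimately show "\<forall>\<^sub>F N in sequentially. \<forall>t :: nat \<Rightarrow> nat.
      (\<forall>j\<in>{1..s}. lehmer_ineqs h (t j) (ray (\<alpha> j) (\<beta> j) N)) \<longrightarrow>
      coefficient h (ray \<nu> \<eta> N)
        (\<Prod>j\<in>{1..s}. schubert (h + t j) (code_perm h (t j) (ray (\<alpha> j) (\<beta> j) N))) = 0"
  proof eventually_elim
    case (elim N)
    let ?d = "\<lambda>j. total_degree h (ray (\<alpha> j) (\<beta> j) N)"
    \<comment> \<open>Degrees in \<open>homog\<close> are natural numbers; nonnegative entries make
      the passage through \<open>nat\<close> lossless.\<close>
    have "0 \<le> ?d j" if "j \<in> {1..s}" for j
      unfolding total_degree_def using elim(2) that by (intro sum_nonneg) auto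
    then have d: "int (\<Sum>j\<in>{1..s}. nat (?d j)) = (\<Sum>j\<in>{1..s}. ?d j)" by simp
    show ?case
    proof (intro allI impI)
      fix t :: "nat \<Rightarrow> nat"
      assume t: "\<forall>j\<in>{1..s}. lehmer_ineqs h (t j) (ray (\<alpha> j) (\<beta> j) N)"
      have "homog (\<Sum>j\<in>{1..s}. nat (?d j))
          (\<Prod>j\<in>{1..s}. schubert (h + t j) (code_perm h (t j) (ray (\<alpha> j) (\<beta> j) N)))"
        using t elim(2) by (intro homog_prod homog_schubert_code) (simp add: valid_code_def)
      then show "coefficient h (ray \<nu> \<eta> N)
          (\<Prod>j\<in>{1..s}. schubert (h + t j) (code_perm h (t j) (ray (\<alpha> j) (\<beta> j) N))) = 0"
        by (rule coefficient_homog) (simp only: d elim(1) not_False_eq_True)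
    qed
  qed
qed

end
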